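(* Let $f\in B^2(\mathbb{R},\mathbb{C})$. Then the closure in $B^2(\mathbb{R},\mathbb{C})$ of the set of translates $\{f(t+\tau):\tau\in\mathbb{R}\}$ is compact and coincides with the equivalence class of $f$ under $\overset{*}{\sim}$.
   Context: For $1\le p<\infty$, the Besicovitch space $B^p(\mathbb{R},\mathbb{C})$ is the completion of the trigonometric polynomials $\sum_{j=1}^n a_je^{i\lambda_jt}$ ($a_j\in\mathbb{C}$, $\lambda_j\in\mathbb{R}$) with respect to the seminorm $\|f\|_{B^p}=\left(\limsup_{l\to\infty}\frac1{2l}\int_{-l}^{l}|f(t)|^p\,dt\right)^{1/p}$; concretely, it consists of the locally $p$-integrable $f:\mathbb{R}\to\mathbb{C}$ such that for every $\varepsilon>0$ there is a trigonometric polynomial $P$ with $\|f-P\|_{B^p}<\varepsilon$. The topology of $B^2(\mathbb{R},\mathbb{C})$ is that of the seminorm $\|\cdot\|_{B^2}$, and functions $f,g\in B^2(\mathbb{R},\mathbb{C})$ with $\|f-g\|_{B^2}=0$ are identified. For $f\in B^1(\mathbb{R},\mathbb{C})\supset B^2(\mathbb{R},\mathbb{C})$ the mean value $M(f)=\lim_{l\to\infty}\frac{1}{2l}\int_{-l}^{l}f(t)\,dt$ exists, and the Fourier coefficient at $\lambda\in\mathbb{R}$ is $a(f,\lambda)=M(f(t)e^{-i\lambda t})$, nonzero for at most countably many $\lambda$. For a countable set $\Lambda=\{\lambda_1,\lambda_2,\ldots\}$ of distinct real numbers (a set of exponents), $f$ is said to have Fourier series $\sum_{j\ge1}a_je^{i\lambda_jt}$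 if $a_j=a(f,\lambda_j)$ for all $j$ (zero values allowed) and $a(f,\lambda)=0$ for $\lambda\notin\Lambda$. $\mathcal{F}_{B^2,\Lambda}$ is the set of $f\in B^2(\mathbb{R},\mathbb{C})$ whose Fourier series is of this form; every $f\in B^2(\mathbb{R},\mathbb{C})$ lies in $\mathcal{F}_{B^2,\Lambda}$ for some set of exponents $\Lambda$. Equivalence relation: if $f_1,f_2$ have Fourier series $\sum_{j\ge1}a_je^{i\lambda_jt}$ and $\sum_{j\ge1}b_je^{i\lambda_jt}$ with $\lambda_j\in\Lambda$, then $f_1\overset{*}{\sim}f_2$ means that for each integer $n\ge1$ (with $n\le\sharp\Lambda$) there is a $\mathbb{Q}$-linear map $\psi_n:V_n\to\mathbb{R}$, where $V_n$ is the $\mathbb{Q}$-vector space generated by $\{\lambda_1,\ldots,\lambda_n\}$, such that $b_j=a_je^{i\psi_n(\lambda_j)}$ for $j=1,\ldots,n$. The equivalence class of $f$ is its class in $\mathcal{F}_{B^2,\Lambda}/\overset{*}{\sim}$, where $f\in\mathcal{F}_{B^2,\Lambda}$. *)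

theory Defs
  imports "HOL-Analysis.Analysis"
begin

definition trig_polynomial :: "(real \<Rightarrow> complex) \<Rightarrow> bool" where
  "trig_polynomial P \<longleftrightarrow>
     (\<exists>(n::nat) (a :: nat \<Rightarrow> complex) (\<omega> :: nat \<Rightarrow> real).
        P = (\<lambda>t. \<Sum>j=1..n. a j * exp (\<i> * of_real (\<omega> j * t))))"

definition locally_p_integrable :: "real \<Rightarrow> (real \<Rightarrow> complex) \<Rightarrow> bool" where
  "locally_p_integrable p f \<longleftrightarrow>
     f \<in> borel_measurable lebesgue \<and>
     (\<forall>a b. set_integrable lebesgue {a..b} (\<lambda>t. cmod (f t) powr p))"

text \<open>
  The seminorm takes values in the extended nonnegative reals, so that an infinite upper limit is
  not confused with a finite one; the \<open>p\<close>-th root of infinity is infinity.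
\<close>

definition besicovitch_limsup :: "real \<Rightarrow> (real \<Rightarrow> complex) \<Rightarrow> ennreal" where
  "besicovitch_limsup p f =
     Limsup at_top (\<lambda>l::real.
       ennreal (1 / (2 * l)) * (\<integral>\<^sup>+t\<in>{-l..l}. ennreal (cmod (f t) powr p) \<partial>lebesgue))"

definition besicovitch_seminorm :: "real \<Rightarrow> (real \<Rightarrow> complex) \<Rightarrow> ennreal" where
  "besicovitch_seminorm p f =
     (if besicovitch_limsup p f = \<infinity> then \<infinity>
      else ennreal (enn2real (besicovitch_limsup p f) powr (1 / p)))"

definition besicovitch :: "real \<Rightarrow> (real \<Rightarrow> complex) set" where
  "besicovitch p =
     {f. locally_p_integrable p f \<and>
         (\<forall>\<epsilon>>0. \<exists>P. trig_polynomial P \<and>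
            besicovitch_seminorm p (\<lambda>t. f t - P t) < ennreal \<epsilon>)}"

text \<open>
  Functions at seminorm distance zero are identified: the points of the space are the classes
  \<open>besicovitch_class p f\<close> with \<open>f \<in> besicovitch p\<close>.
  A set \<open>U\<close> of points is open iff with the class of \<open>f\<close> it contains the classes of all functions in
  some seminorm ball around \<open>f\<close>, i.e. the space carries the quotient of the seminorm topology.
\<close>

definition besicovitch_class :: "real \<Rightarrow> (real \<Rightarrow> complex) \<Rightarrow> (real \<Rightarrow> complex) set" where
  "besicovitch_class p f =
     {g \<in> besicovitch p. besicovitch_seminorm p (\<lambda>t. f t - g t) = 0}"

definition besicovitch_open :: "real \<Rightarrow> (real \<Rightarrow> complex) set set \<Rightarrow> bool" where
  "besicovitch_open p U \<longleftrightarrow>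
     U \<subseteq> besicovitch_class p ` besicovitch p \<and>
     (\<forall>f \<in> besicovitch p. besicovitch_class p f \<in> U \<longrightarrow>
        (\<exists>\<epsilon>>0. \<forall>g \<in> besicovitch p.
           besicovitch_seminorm p (\<lambda>t. g t - f t) < ennreal \<epsilon> \<longrightarrow> besicovitch_class p g \<in> U))"

definition besicovitch_topology :: "real \<Rightarrow> (real \<Rightarrow> complex) set topology" where
  "besicovitch_topology p = topology (besicovitch_open p)"

lemma besicovitch_openE:
  assumes "besicovitch_open p U" "f \<in> besicovitch p" "besicovitch_class p f \<in> U"
  obtains \<epsilon> where "\<epsilon> > 0"
    "\<forall>g \<in> besicovitch p. besicovitch_seminorm p (\<lambda>t. g t - f t) < ennreal \<epsilon> \<longrightarrow>
       besicovitch_class p g \<in> U"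
  using assms(1)[unfolded besicovitch_open_def, THEN conjunct2, rule_format, OF assms(2,3)]
  by (elim exE conjE) (rule that)

lemma besicovitch_open_subset:
  "besicovitch_open p U \<Longrightarrow> U \<subseteq> besicovitch_class p ` besicovitch p"
  unfolding besicovitch_open_def by (rule conjunct1)

lemma istopology_besicovitch_open: "istopology (besicovitch_open p)"
  unfolding istopology_def
proof (intro conjI allI impI)
  fix S T assume S: "besicovitch_open p S" and T: "besicovitch_open p T"
  have *: "\<exists>\<epsilon>>0. \<forall>g \<in> besicovitch p.
      besicovitch_seminorm p (\<lambda>t. g t - f t) < ennreal \<epsilon> \<longrightarrow> besicovitch_class p g \<in> S \<inter> T"
    if f: "f \<in> besicovitch p" "besicovitch_class p f \<in> S \<inter> T" for f
  proof -
    obtain d where d: "d > 0" "\<forall>g \<in> besicovitch p.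
        besicovitch_seminorm p (\<lambda>t. g t - f t) < ennreal d \<longrightarrow> besicovitch_class p g \<in> S"
      using besicovitch_openE[OF S f(1) IntD1[OF f(2)]] .
    obtain e where e: "e > 0" "\<forall>g \<in> besicovitch p.
        besicovitch_seminorm p (\<lambda>t. g t - f t) < ennreal e \<longrightarrow> besicovitch_class p g \<in> T"
      using besicovitch_openE[OF T f(1) IntD2[OF f(2)]] .
    have le: "ennreal (min d e) \<le> ennreal d" "ennreal (min d e) \<le> ennreal e"
      by (rule ennreal_leI, simp)+
    show ?thesis
    proof (intro exI conjI ballI impI)
      show "0 < min d e" using d(1) e(1) by simp
      fix g assume g: "g \<in> besicovitch p"
        "besicovitch_seminorm p (\<lambda>t. g t - f t) < ennreal (min d e)"
      show "besicovitch_class p g \<in> S \<inter> T"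
        using d(2)[rule_format, OF g(1) less_le_trans[OF g(2) le(1)]]
          e(2)[rule_format, OF g(1) less_le_trans[OF g(2) le(2)]] by (rule IntI)
    qed
  qed
  show "besicovitch_open p (S \<inter> T)"
    unfolding besicovitch_open_def
    using * besicovitch_open_subset[OF S] by (intro conjI ballI impI) (rule le_infI1)
next
  fix K assume K: "\<forall>S\<in>K. besicovitch_open p S"
  have *: "\<exists>\<epsilon>>0. \<forall>g \<in> besicovitch p.
      besicovitch_seminorm p (\<lambda>t. g t - f t) < ennreal \<epsilon> \<longrightarrow> besicovitch_class p g \<in> \<Union>K"
    if f: "f \<in> besicovitch p" "besicovitch_class p f \<in> \<Union>K" for f
  proof -
    obtain S where S: "S \<in> K" "besicovitch_class p f \<in> S" using f(2) by (rule UnionE)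
    obtain e where e: "e > 0" "\<forall>g \<in> besicovitch p.
        besicovitch_seminorm p (\<lambda>t. g t - f t) < ennreal e \<longrightarrow> besicovitch_class p g \<in> S"
      using besicovitch_openE[OF K[rule_format, OF S(1)] f(1) S(2)] .
    show ?thesis
      using e(1) UnionI[OF S(1) e(2)[rule_format]] by (intro exI[of _ e] conjI ballI impI)
  qed
  show "besicovitch_open p (\<Union>K)"
    unfolding besicovitch_open_def
    using * besicovitch_open_subset K by (intro conjI ballI impI Union_least) blast+
qed

lemma openin_besicovitch_topology: "openin (besicovitch_topology p) = besicovitch_open p"
  unfolding besicovitch_topology_def
  by (rule topology_inverse'[OF istopology_besicovitch_open])

lemma topspace_besicovitch_topology:
  "topspace (besicovitch_topology p) = besicovitch_class p ` besicovitch p"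
proof -
  have "besicovitch_open p (besicovitch_class p ` besicovitch p)"
    unfolding besicovitch_open_def by (intro conjI ballI impI exI[of _ "1::real"]) simp_all
  moreover have "U \<subseteq> besicovitch_class p ` besicovitch p" if "besicovitch_open p U" for U
    using that unfolding besicovitch_open_def by blast
  ultimately show ?thesis
    unfolding topspace_def openin_besicovitch_topology by blast
qed

definition translates_closure :: "real \<Rightarrow> (real \<Rightarrow> complex) \<Rightarrow> (real \<Rightarrow> complex) set set" where
  "translates_closure p f =
     besicovitch_topology p closure_of (range (\<lambda>\<tau>. besicovitch_class p (\<lambda>t. f (t + \<tau>))))"

definition mean_value :: "(real \<Rightarrow> complex) \<Rightarrow> complex" where
  "mean_value f =
     Lim at_top (\<lambda>l::real. of_real (1 / (2 * l)) * (LINT t:{-l..l}|lebesgue. f t))"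

definition fourier_coeff :: "(real \<Rightarrow> complex) \<Rightarrow> real \<Rightarrow> complex" where
  "fourier_coeff f \<omega> = mean_value (\<lambda>t. f t * exp (- \<i> * of_real (\<omega> * t)))"

text \<open>
  A set of exponents \<open>\<Lambda>\<close> comes with an enumeration \<open>\<omega> 1, \<omega> 2, \<dots>\<close> without repetitions, finite or
  infinite; the admissible indices are the \<open>j \<ge> 1\<close> not exceeding the cardinality of \<open>\<Lambda>\<close>.
\<close>

definition exponent_indices :: "real set \<Rightarrow> nat set" where
  "exponent_indices \<Lambda> = {j. 1 \<le> j \<and> (finite \<Lambda> \<longrightarrow> j \<le> card \<Lambda>)}"

definition exponent_enumeration :: "real set \<Rightarrow> (nat \<Rightarrow> real) \<Rightarrow> bool" where
  "exponent_enumeration \<Lambda> \<omega> \<longleftrightarrow> bij_betw \<omega> (exponent_indices \<Lambda>) \<Lambda>"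

definition has_fourier_series ::
    "(real \<Rightarrow> complex) \<Rightarrow> real set \<Rightarrow> (nat \<Rightarrow> real) \<Rightarrow> (nat \<Rightarrow> complex) \<Rightarrow> bool" where
  "has_fourier_series f \<Lambda> \<omega> a \<longleftrightarrow>
     (\<forall>j \<in> exponent_indices \<Lambda>. a j = fourier_coeff f (\<omega> j)) \<and>
     (\<forall>\<mu>. \<mu> \<notin> \<Lambda> \<longrightarrow> fourier_coeff f \<mu> = 0)"

definition fourier_class_B2 :: "real set \<Rightarrow> (nat \<Rightarrow> real) \<Rightarrow> (real \<Rightarrow> complex) set" where
  "fourier_class_B2 \<Lambda> \<omega> = {f \<in> besicovitch 2. \<exists>a. has_fourier_series f \<Lambda> \<omega> a}"

global_interpretation rat_real: vector_space "\<lambda>(q::rat) (x::real). of_rat q * x"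
  by unfold_locales (simp_all add: distrib_left distrib_right of_rat_add of_rat_mult)

definition rat_linear_on :: "real set \<Rightarrow> (real \<Rightarrow> real) \<Rightarrow> bool" where
  "rat_linear_on V \<psi> \<longleftrightarrow>
     (\<forall>x\<in>V. \<forall>y\<in>V. \<psi> (x + y) = \<psi> x + \<psi> y) \<and>
     (\<forall>(q::rat). \<forall>x\<in>V. \<psi> (of_rat q * x) = of_rat q * \<psi> x)"

definition bohr_equiv ::
    "real set \<Rightarrow> (nat \<Rightarrow> real) \<Rightarrow> ((real \<Rightarrow> complex) \<times> (real \<Rightarrow> complex)) set" where
  "bohr_equiv \<Lambda> \<omega> =
     {(f\<^sub>1, f\<^sub>2). f\<^sub>1 \<in> fourier_class_B2 \<Lambda> \<omega> \<and> f\<^sub>2 \<in> fourier_class_B2 \<Lambda> \<omega> \<and>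
        (\<exists>a b. has_fourier_series f\<^sub>1 \<Lambda> \<omega> a \<and> has_fourier_series f\<^sub>2 \<Lambda> \<omega> b \<and>
          (\<forall>n \<in> exponent_indices \<Lambda>. \<exists>\<psi>. rat_linear_on (rat_real.span (\<omega> ` {1..n})) \<psi> \<and>
             (\<forall>j\<in>{1..n}. b j = a j * exp (\<i> * of_real (\<psi> (\<omega> j))))))}"

end

theory Submission
  imports Defs
begin

text \<open>
  Write \<open>f\<^sub>\<tau>\<close> for the translate \<open>t \<mapsto> f (t + \<tau>)\<close>. A translation acts on Fourier coefficients by
  \<open>a(f\<^sub>\<tau>, \<mu>) = a(f, \<mu>) e\<^sup>i\<^sup>\<mu>\<^sup>\<tau>\<close> (\<open>fourier_coeff_translation\<close>), so the claim is a statement about limits of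
  the characters \<open>\<mu> \<mapsto> e\<^sup>i\<^sup>\<mu>\<^sup>\<tau>\<close>, once the seminorm is tied to the Fourier coefficients.

  This tie has two halves. A coefficient depends continuously on the function, because a mean
  value is bounded by the root mean square (\<open>fourier_coeff_diff_le\<close>). Conversely, finitely many
  coefficients determine a function up to any given error: among the trigonometric polynomials
  with exponents in a finite set, the Fourier sum approximates best, by orthogonality of the
  remainder to these exponentials, and hence the Fourier sums of an element of \<open>B\<^sup>2\<close> converge to it
  along the finite sets of exponents (\<open>fourier_sums_converge\<close>).

  If translates \<open>f\<^sub>\<tau>\<close> with \<open>\<tau> = \<tau>\<^sub>k\<close> tend to \<open>g\<close>, the coefficients converge, and \<open>g\<close> has no exponents
  outside \<open>\<Lambda>\<close>. Among finitely many exponents choose a basis of their span over the rationals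
  and divide it by a common denominator, so that the exponents become integral combinations. A
  subsequence of the characters converges on the divided basis; arguments of the limits,
  extended linearly over the rationals, give the required map \<open>\<psi>\<close>
  (\<open>character_limit_is_rat_linear\<close>). Conversely, if \<open>\<psi>\<close> is given, Kronecker's theorem for the
  linearly independent basis produces \<open>\<tau>\<close> such that \<open>e\<^sup>i\<^sup>\<mu>\<^sup>\<tau>\<close> is close to \<open>e\<^sup>i\<^sup>\<psi>\<^sup>(\<^sup>\<mu>\<^sup>)\<close> at finitely many
  exponents (\<open>rat_linear_approximated_by_characters\<close>); comparing Fourier sums shows that \<open>f\<^sub>\<tau>\<close> is
  close to \<open>g\<close>.

  For the compactness, the seminorm makes the classes a metric space whose topology is the given
  one. It is complete: a Cauchy sequence is glued into a single function that agrees with the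
  \<open>k\<close>-th term on a shell \<open>r k < \<bar>t\<bar> \<le> r (k + 1)\<close>, with radii that grow fast enough
  (\<open>besicovitch_complete\<close>). The translates are totally bounded: all exponents of a sequence of
  approximating trigonometric polynomials form a countable set, so any sequence of translation
  parameters has a subsequence along which the characters converge at each of them, and the
  translates form a Cauchy sequence along it (\<open>translates_totally_bounded\<close>).
\<close>


section \<open>Locally square integrable functions\<close>

lemma locally_p_integrable_2_iff:
  "locally_p_integrable 2 f \<longleftrightarrow> f \<in> borel_measurable lebesgue \<and>
     (\<forall>a b. set_integrable lebesgue {a..b} (\<lambda>t. (cmod (f t))\<^sup>2))"
  by (simp add: locally_p_integrable_def)

lemma L2loc_measurable [measurable_dest]:
  "locally_p_integrable 2 f \<Longrightarrow> f \<in> borel_measurable lebesgue"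
  by (simp add: locally_p_integrable_2_iff)

lemma L2loc_square_integrable:
  "locally_p_integrable 2 f \<Longrightarrow> set_integrable lebesgue {a..b} (\<lambda>t. (cmod (f t))\<^sup>2)"
  by (simp add: locally_p_integrable_2_iff)

lemma set_integrable_lebesgue_bound:
  fixes f :: "real \<Rightarrow> 'b::{banach,second_countable_topology}" and h :: "real \<Rightarrow> real"
  assumes "set_integrable lebesgue {a..b} h" "f \<in> borel_measurable lebesgue"
    and "\<And>t. t \<in> {a..b} \<Longrightarrow> norm (f t) \<le> h t"
  shows "set_integrable lebesgue {a..b} f"
proof (rule set_integrable_bound[OF assms(1)])
  show "set_borel_measurable lebesgue {a..b} f"
    unfolding set_borel_measurable_def using assms(2)
    by (intro borel_measurable_scaleR borel_measurable_indicator) auto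
  show "AE t in lebesgue. t \<in> {a..b} \<longrightarrow> norm (f t) \<le> norm (h t)"
    using assms(3) by (intro AE_I2) fastforce
qed

lemma L2loc_bound:
  assumes "f \<in> borel_measurable lebesgue"
    and "\<And>a b. set_integrable lebesgue {a..b} (h a b)"
    and "\<And>a b t. t \<in> {a..b} \<Longrightarrow> (cmod (f t))\<^sup>2 \<le> h a b t"
  shows "locally_p_integrable 2 f"
  unfolding locally_p_integrable_2_iff using assms(1)
  by (auto intro!: set_integrable_lebesgue_bound[OF assms(2)] assms(3))

lemma set_integrable_const_Icc [simp]:
  "set_integrable lebesgue {a..b::real} (\<lambda>_. c :: 'b::{banach,second_countable_topology})"
  unfolding set_integrable_def by (intro integrable_scaleR_left integrable_real_indicator)
     (auto simp: emeasure_lborel_Icc_eq)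

text \<open>
  The free weight \<open>s\<close> makes this linear in the squares, so that it can be integrated. Optimising
  \<open>s\<close> after the integration gives Minkowski's inequality.
\<close>

lemma cmod_add_sq_le:
  assumes "s > 0"
  shows "(cmod (u + v))\<^sup>2 \<le> (1 + s) * (cmod u)\<^sup>2 + (1 + 1 / s) * (cmod v)\<^sup>2"
proof -
  have "(cmod (u + v))\<^sup>2 \<le> (cmod u + cmod v)\<^sup>2"
    by (intro power_mono norm_triangle_ineq) auto
  also have "\<dots> = (cmod u)\<^sup>2 + (cmod v)\<^sup>2 + 2 * cmod u * cmod v"
    by (simp add: power2_sum)
  also have "2 * cmod u * cmod v \<le> s * (cmod u)\<^sup>2 + (1 / s) * (cmod v)\<^sup>2"
  proof -
    have "0 \<le> (s * cmod u - cmod v)\<^sup>2 / s" using assms by simp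
    also have "\<dots> = s * (cmod u)\<^sup>2 + (1 / s) * (cmod v)\<^sup>2 - 2 * cmod u * cmod v"
      using assms by (simp add: power2_eq_square field_simps)
    finally show ?thesis by simp
  qed
  finally show ?thesis by (simp add: algebra_simps)
qed

lemma L2loc_add:
  assumes "locally_p_integrable 2 f" "locally_p_integrable 2 g"
  shows "locally_p_integrable 2 (\<lambda>t. f t + g t)"
proof (rule L2loc_bound)
  note [measurable] = assms[THEN L2loc_measurable]
  show "(\<lambda>t. f t + g t) \<in> borel_measurable lebesgue" by measurable
  show "set_integrable lebesgue {a..b} (\<lambda>t. 2 * (cmod (f t))\<^sup>2 + 2 * (cmod (g t))\<^sup>2)" for a b
    by (intro set_integral_add set_integrable_mult_right impI L2loc_square_integrable assms)
  show "(cmod (f t + g t))\<^sup>2 \<le> 2 * (cmod (f t))\<^sup>2 + 2 * (cmod (g t))\<^sup>2" for t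
    using cmod_add_sq_le[of 1 "f t" "g t"] by simp
qed

lemma L2loc_mult_bounded:
  assumes "locally_p_integrable 2 f" "u \<in> borel_measurable lebesgue" "\<And>t. cmod (u t) \<le> C"
  shows "locally_p_integrable 2 (\<lambda>t. u t * f t)"
proof (rule L2loc_bound)
  note [measurable] = assms(1)[THEN L2loc_measurable] assms(2)
  show "(\<lambda>t. u t * f t) \<in> borel_measurable lebesgue" by measurable
  show "set_integrable lebesgue {a..b} (\<lambda>t. C\<^sup>2 * (cmod (f t))\<^sup>2)" for a b
    by (intro set_integrable_mult_right impI L2loc_square_integrable assms)
  show "(cmod (u t * f t))\<^sup>2 \<le> C\<^sup>2 * (cmod (f t))\<^sup>2" for t
    using assms(3)[of t] by (auto simp: norm_mult power_mult_distrib intro!: mult_right_mono power_mono)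
qed

lemma L2loc_cmult: "locally_p_integrable 2 f \<Longrightarrow> locally_p_integrable 2 (\<lambda>t. c * f t)"
  by (rule L2loc_mult_bounded[where u = "\<lambda>_. c" and C = "cmod c"]) auto

lemma L2loc_diff:
  assumes "locally_p_integrable 2 f" "locally_p_integrable 2 g"
  shows "locally_p_integrable 2 (\<lambda>t. f t - g t)"
  using L2loc_add[OF assms(1) L2loc_cmult[OF assms(2), of "-1"]] by simp

lemma L2loc_bounded:
  assumes "u \<in> borel_measurable lebesgue" "\<And>t. cmod (u t) \<le> C"
  shows "locally_p_integrable 2 u"
  using assms by (intro L2loc_bound[where h = "\<lambda>_ _ _. C\<^sup>2"]) (auto intro!: power_mono)

lemma L2loc_product_integrable:
  assumes "locally_p_integrable 2 f" "locally_p_integrable 2 g"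
  shows "set_integrable lebesgue {a..b} (\<lambda>t. f t * g t)"
proof (rule set_integrable_lebesgue_bound)
  note [measurable] = assms[THEN L2loc_measurable]
  show "(\<lambda>t. f t * g t) \<in> borel_measurable lebesgue" by measurable
  show "set_integrable lebesgue {a..b} (\<lambda>t. (cmod (f t))\<^sup>2 + (cmod (g t))\<^sup>2)"
    by (intro set_integral_add L2loc_square_integrable assms)
  show "norm (f t * g t) \<le> (cmod (f t))\<^sup>2 + (cmod (g t))\<^sup>2" for t
  proof -
    have "norm (f t * g t) \<le> 2 * cmod (f t) * cmod (g t)" by (simp add: norm_mult)
    also have "\<dots> \<le> (cmod (f t))\<^sup>2 + (cmod (g t))\<^sup>2" by (rule sum_squares_bound)
    finally show ?thesis .
  qed
qed

lemma L2loc_integrable: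
  assumes "locally_p_integrable 2 f"
  shows "set_integrable lebesgue {a..b} f"
  using L2loc_product_integrable[OF assms L2loc_bounded[of "\<lambda>_. 1" 1]] by simp

lemma measurable_lebesgue_translation [measurable]:
  "(\<lambda>x::real. c + x) \<in> lebesgue \<rightarrow>\<^sub>M lebesgue"
  using lebesgue_affine_measurable[of "\<lambda>_. 1" c] by simp

lemma set_integrable_translation_iff:
  fixes h :: "real \<Rightarrow> 'b::euclidean_space"
  shows "set_integrable lebesgue {a..b} (\<lambda>t. h (t + \<tau>)) \<longleftrightarrow>
         set_integrable lebesgue {a + \<tau>..b + \<tau>} h"
proof -
  have eq: "(\<lambda>t. indicator {a..b} t *\<^sub>R h (t + \<tau>)) =
      (\<lambda>t. indicator {a + \<tau>..b + \<tau>} (\<tau> + 1 * t) *\<^sub>R h (\<tau> + 1 * t))"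
    by (auto simp: fun_eq_iff indicator_def add.commute)
  show ?thesis unfolding set_integrable_def eq
    by (rule lebesgue_integrable_real_affine_iff) simp
qed

lemma set_integral_translation:
  fixes h :: "real \<Rightarrow> 'b::euclidean_space"
  shows "(LINT t:{a..b}|lebesgue. h (t + \<tau>)) = (LINT t:{a + \<tau>..b + \<tau>}|lebesgue. h t)"
proof -
  have eq: "(\<lambda>t. indicator {a..b} t *\<^sub>R h (t + \<tau>)) =
      (\<lambda>t. indicator {a + \<tau>..b + \<tau>} (\<tau> + 1 * t) *\<^sub>R h (\<tau> + 1 * t))"
    by (auto simp: fun_eq_iff indicator_def add.commute)
  show ?thesis unfolding set_lebesgue_integral_def eq
    by (subst lebesgue_integral_real_affine[of 1 _ \<tau>]) simp_all
qed

lemma L2loc_translation: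
  assumes "locally_p_integrable 2 f"
  shows "locally_p_integrable 2 (\<lambda>t. f (t + \<tau>))"
proof -
  have "(\<lambda>t. f (\<tau> + t)) \<in> borel_measurable lebesgue"
    by (rule measurable_compose[OF measurable_lebesgue_translation L2loc_measurable[OF assms]])
  then show ?thesis
    using L2loc_square_integrable[OF assms]
      set_integrable_translation_iff[of _ _ "\<lambda>t. (cmod (f t))\<^sup>2" \<tau>]
    by (simp add: locally_p_integrable_2_iff add.commute)
qed

section \<open>Root mean squares over symmetric intervals\<close>

definition mean_square :: "(real \<Rightarrow> complex) \<Rightarrow> real \<Rightarrow> real" where
  "mean_square f l = 1 / (2 * l) * (LINT t:{-l..l}|lebesgue. (cmod (f t))\<^sup>2)"

definition rms :: "(real \<Rightarrow> complex) \<Rightarrow> real \<Rightarrow> real" where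
  "rms f l = sqrt (mean_square f l)"

definition average :: "(real \<Rightarrow> complex) \<Rightarrow> real \<Rightarrow> complex" where
  "average f l = of_real (1 / (2 * l)) * (LINT t:{-l..l}|lebesgue. f t)"

lemma set_integral_nonneg_real:
  fixes f :: "real \<Rightarrow> real"
  shows "(\<And>t. f t \<ge> 0) \<Longrightarrow> 0 \<le> (LINT t:A|M. f t)"
  by (auto intro!: Bochner_Integration.integral_nonneg simp: set_lebesgue_integral_def)

lemma mean_square_nonneg: "l > 0 \<Longrightarrow> 0 \<le> mean_square f l"
  unfolding mean_square_def by (intro mult_nonneg_nonneg set_integral_nonneg_real) auto

lemma rms_nonneg: "l > 0 \<Longrightarrow> 0 \<le> rms f l"
  by (simp add: rms_def mean_square_nonneg)

lemma rms_sq: "l > 0 \<Longrightarrow> (rms f l)\<^sup>2 = mean_square f l"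
  by (simp add: rms_def mean_square_nonneg)

lemma set_integral_const_Icc:
  "a \<le> b \<Longrightarrow> (LINT t:{a..b}|lebesgue. (c::real)) = (b - a) * c"
  by (simp add: set_lebesgue_integral_def)

text \<open>
  The Cauchy-Schwarz inequality against the constant 1, in the form
  \<open>\<bar>h\<bar> \<le> c/2 + \<bar>h\<bar>\<^sup>2/(2c)\<close> for each \<open>c\<close> above the root mean square.
\<close>

lemma cmod_average_le_rms:
  assumes "locally_p_integrable 2 h" "l > 0"
  shows "cmod (average h l) \<le> rms h l"
proof (rule dense_ge)
  fix c assume c: "rms h l < c"
  then have "c > 0" using rms_nonneg[OF assms(2)] by (meson le_less_trans)
  have "cmod (LINT t:{-l..l}|lebesgue. h t) \<le> (LINT t:{-l..l}|lebesgue. cmod (h t))"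
    by (intro set_integral_norm_bound L2loc_integrable assms)
  also have "\<dots> \<le> (LINT t:{-l..l}|lebesgue. c / 2 + 1 / (2 * c) * (cmod (h t))\<^sup>2)"
  proof (rule set_integral_mono)
    show "set_integrable lebesgue {-l..l} (\<lambda>t. cmod (h t))"
      by (rule set_integrable_norm[OF L2loc_integrable[OF assms(1)]])
    show "set_integrable lebesgue {-l..l} (\<lambda>t. c / 2 + 1 / (2 * c) * (cmod (h t))\<^sup>2)"
      by (intro set_integral_add set_integrable_mult_right set_integrable_const_Icc impI L2loc_square_integrable assms)
    show "cmod (h t) \<le> c / 2 + 1 / (2 * c) * (cmod (h t))\<^sup>2" for t
    proof -
      have "0 \<le> (c - cmod (h t))\<^sup>2 / (2 * c)" using \<open>c > 0\<close> by simp
      also have "\<dots> = c / 2 + 1 / (2 * c) * (cmod (h t))\<^sup>2 - cmod (h t)"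
        using \<open>c > 0\<close> by (simp add: power2_eq_square field_simps)
      finally show ?thesis by simp
    qed
  qed
  also have "\<dots> = l * c + 1 / (2 * c) * (LINT t:{-l..l}|lebesgue. (cmod (h t))\<^sup>2)"
    by (subst set_integral_add) (auto intro!: L2loc_square_integrable assms(1) set_integrable_mult_right
         simp: set_integral_const_Icc assms(2) less_imp_le[OF assms(2)])
  finally have "cmod (LINT t:{-l..l}|lebesgue. h t) \<le> 
      l * c + 1 / (2 * c) * (LINT t:{-l..l}|lebesgue. (cmod (h t))\<^sup>2)" .
  then have "cmod (average h l) \<le> 
      1 / (2 * l) * (l * c + 1 / (2 * c) * (LINT t:{-l..l}|lebesgue. (cmod (h t))\<^sup>2))"
    using assms(2) by (simp add: average_def norm_mult norm_divide divide_right_mono)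
  also have "\<dots> = (c + mean_square h l / c) / 2"
    using assms(2) \<open>c > 0\<close> by (simp add: mean_square_def field_simps)
  also have "\<dots> \<le> c"
  proof -
    have "mean_square h l \<le> c\<^sup>2"
      using c rms_nonneg[OF assms(2), of h] unfolding rms_sq[OF assms(2), symmetric]
      by (intro power_mono) auto
    then show ?thesis using \<open>c > 0\<close> by (simp add: field_simps power2_eq_square)
  qed
  finally show "cmod (average h l) \<le> c" .
qed

lemma mean_square_add_le:
  assumes "locally_p_integrable 2 f" "locally_p_integrable 2 g" "l > 0" "s > 0"
  shows "mean_square (\<lambda>t. f t + g t) l \<le> (1 + s) * mean_square f l + (1 + 1 / s) * mean_square g l"
proof -
  have "(LINT t:{-l..l}|lebesgue. (cmod (f t + g t))\<^sup>2) \<le>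
        (LINT t:{-l..l}|lebesgue. (1 + s) * (cmod (f t))\<^sup>2 + (1 + 1 / s) * (cmod (g t))\<^sup>2)"
    by (intro set_integral_mono set_integral_add set_integrable_mult_right impI
        L2loc_square_integrable L2loc_add assms cmod_add_sq_le)
  also have "\<dots> = (1 + s) * (LINT t:{-l..l}|lebesgue. (cmod (f t))\<^sup>2) +
      (1 + 1 / s) * (LINT t:{-l..l}|lebesgue. (cmod (g t))\<^sup>2)"
    by (subst set_integral_add)
       (auto intro!: L2loc_square_integrable assms(1,2) set_integrable_mult_right)
  finally have "mean_square (\<lambda>t. f t + g t) l \<le> 1 / (2 * l) * \<dots>"
    unfolding mean_square_def using assms(3) by (intro mult_left_mono) auto
  then show ?thesis by (simp add: mean_square_def algebra_simps add_divide_distrib)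
qed

text \<open>
  Minkowski's inequality: with upper bounds \<open>X\<close> and \<open>Y\<close> of the two root mean squares, the weight
  \<open>s = Y/X\<close> turns the bound for the mean square of the sum into \<open>(X + Y)\<^sup>2\<close>.
\<close>

lemma rms_triangle:
  assumes "locally_p_integrable 2 f" "locally_p_integrable 2 g" "l > 0"
  shows "rms (\<lambda>t. f t + g t) l \<le> rms f l + rms g l"
proof (rule field_le_epsilon)
  fix e :: real assume "e > 0"
  \<comment> \<open>The summand \<open>e / 2\<close> keeps the weight \<open>Y / X\<close> meaningful when a root mean square vanishes.\<close>
  define X Y where "X = rms f l + e / 2" and "Y = rms g l + e / 2"
  have XY: "X > 0" "Y > 0"
    using rms_nonneg[OF assms(3)] \<open>e > 0\<close> by (auto simp: X_def Y_def add_nonneg_pos)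
  have le: "mean_square f l \<le> X\<^sup>2" "mean_square g l \<le> Y\<^sup>2"
    using rms_nonneg[OF assms(3)] \<open>e > 0\<close> unfolding rms_sq[OF assms(3), symmetric] X_def Y_def
    by (auto intro!: power_mono)
  have "mean_square (\<lambda>t. f t + g t) l \<le>
      (1 + Y / X) * mean_square f l + (1 + 1 / (Y / X)) * mean_square g l"
    using XY by (intro mean_square_add_le assms) auto
  also have "\<dots> \<le> (1 + Y / X) * X\<^sup>2 + (1 + 1 / (Y / X)) * Y\<^sup>2"
    using XY le by (intro add_mono mult_left_mono) auto
  also have "\<dots> = (X + Y)\<^sup>2"
    using XY by (simp add: field_simps power2_eq_square)
  finally have "rms (\<lambda>t. f t + g t) l \<le> X + Y"
    unfolding rms_def using XY by (intro real_le_lsqrt) auto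
  then show "rms (\<lambda>t. f t + g t) l \<le> rms f l + rms g l + e" by (simp add: X_def Y_def)
qed

lemma set_integral_Icc_mono:
  fixes h :: "real \<Rightarrow> real"
  assumes "set_integrable lebesgue {c..d} h" "\<And>t. h t \<ge> 0" "c \<le> a" "b \<le> d"
  shows "(LINT t:{a..b}|lebesgue. h t) \<le> (LINT t:{c..d}|lebesgue. h t)"
proof -
  have "set_integrable lebesgue {a..b} h"
    by (rule set_integrable_subset[OF assms(1)]) (use assms in auto)
  then show ?thesis unfolding set_lebesgue_integral_def using assms
    by (intro integral_mono) (auto simp: set_integrable_def indicator_def)
qed

text \<open>
  The interval of length \<open>2l\<close> moved by \<open>\<tau>\<close> lies in the symmetric one of half length \<open>l + \<bar>\<tau>\<bar>\<close>; the
  factor comes from the change of normalisation and tends to 1.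
\<close>

lemma rms_translation_le:
  assumes "locally_p_integrable 2 f" "l > 0"
  shows "rms (\<lambda>t. f (t + \<tau>)) l \<le> sqrt ((l + \<bar>\<tau>\<bar>) / l) * rms f (l + \<bar>\<tau>\<bar>)"
proof -
  have "(LINT t:{-l..l}|lebesgue. (cmod (f (t + \<tau>)))\<^sup>2) = 
        (LINT t:{-l + \<tau>..l + \<tau>}|lebesgue. (cmod (f t))\<^sup>2)"
    by (rule set_integral_translation)
  also have "\<dots> \<le> (LINT t:{-(l + \<bar>\<tau>\<bar>)..l + \<bar>\<tau>\<bar>}|lebesgue. (cmod (f t))\<^sup>2)"
    by (intro set_integral_Icc_mono L2loc_square_integrable assms) auto
  finally have "mean_square (\<lambda>t. f (t + \<tau>)) l \<le> 1 / (2 * l) * \<dots>"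
    unfolding mean_square_def using assms(2) by (intro mult_left_mono) auto
  also have "\<dots> = (l + \<bar>\<tau>\<bar>) / l * mean_square f (l + \<bar>\<tau>\<bar>)"
  proof -
    have "1 / (2 * l) * I = (l + T) / l * (1 / (2 * (l + T)) * I)" if "T \<ge> 0" for I T :: real
      using assms(2) that by (simp add: divide_simps)
    then show ?thesis unfolding mean_square_def by simp
  qed
  finally show ?thesis
    unfolding rms_def real_sqrt_mult[symmetric] by (rule real_sqrt_le_mono)
qed

section \<open>The Besicovitch seminorm\<close>

lemma besicovitch_limsup_eq_mean_square:
  assumes "locally_p_integrable 2 f"
  shows "besicovitch_limsup 2 f = Limsup at_top (\<lambda>l. ennreal (mean_square f l))"
  unfolding besicovitch_limsup_def
proof (rule Limsup_eq, rule eventually_mono[OF eventually_gt_at_top[of 0]])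
  fix l :: real assume "l > 0"
  have "(\<integral>\<^sup>+t\<in>{-l..l}. ennreal (cmod (f t) powr 2) \<partial>lebesgue) = 
        ennreal (LINT t:{-l..l}|lebesgue. (cmod (f t))\<^sup>2)"
  proof -
    have "(\<integral>\<^sup>+t\<in>{-l..l}. ennreal (cmod (f t) powr 2) \<partial>lebesgue) =
        (\<integral>\<^sup>+t. ennreal (indicator {-l..l} t *\<^sub>R (cmod (f t))\<^sup>2) \<partial>lebesgue)"
      by (intro nn_integral_cong) (auto split: split_indicator)
    also have "\<dots> = ennreal (LINT t:{-l..l}|lebesgue. (cmod (f t))\<^sup>2)"
      unfolding set_lebesgue_integral_def
      by (intro nn_integral_eq_integral L2loc_square_integrable[OF assms, unfolded set_integrable_def]) auto
    finally show ?thesis .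
  qed
  then show "ennreal (1 / (2 * l)) * (\<integral>\<^sup>+t\<in>{-l..l}. ennreal (cmod (f t) powr 2) \<partial>lebesgue) =
      ennreal (mean_square f l)"
    unfolding mean_square_def using \<open>l > 0\<close>
    by (simp add: ennreal_mult[symmetric] set_integral_nonneg_real)
qed

text \<open>
  This translates the extended-valued upper limit into a statement about real root mean squares.
  All later estimates of the seminorm go through it or through its consequences.
\<close>

lemma besicovitch_seminorm_le_iff:
  assumes "locally_p_integrable 2 f" "c \<ge> 0"
  shows "besicovitch_seminorm 2 f \<le> ennreal c \<longleftrightarrow> (\<forall>e>0. \<forall>\<^sub>F l in at_top. rms f l \<le> c + e)"
proof -
  have "besicovitch_seminorm 2 f \<le> ennreal c \<longleftrightarrow> besicovitch_limsup 2 f \<le> ennreal (c\<^sup>2)"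
  proof (cases "besicovitch_limsup 2 f")
    case (real x)
    then show ?thesis using assms(2) real_le_lsqrt[of c x] sqrt_le_D[of x c]
      by (auto simp: besicovitch_seminorm_def powr_half_sqrt)
  qed (auto simp: besicovitch_seminorm_def top_unique)
  also have "\<dots> \<longleftrightarrow> (\<forall>y>ennreal (c\<^sup>2). \<forall>\<^sub>F l in at_top. ennreal (mean_square f l) < y)"
    unfolding besicovitch_limsup_eq_mean_square[OF assms(1)] by (rule Limsup_le_iff)
  also have "\<dots> \<longleftrightarrow> (\<forall>e>0. \<forall>\<^sub>F l in at_top. rms f l \<le> c + e)"
  proof safe
    fix e :: real assume e: "e > 0" 
      and *: "\<forall>y>ennreal (c\<^sup>2). \<forall>\<^sub>F l in at_top. ennreal (mean_square f l) < y"
    have "ennreal (c\<^sup>2) < ennreal ((c + e)\<^sup>2)"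
      using e assms(2) by (intro ennreal_lessI) (auto intro!: power_strict_mono)
    with * have "\<forall>\<^sub>F l in at_top. ennreal (mean_square f l) < ennreal ((c + e)\<^sup>2)" by blast
    then show "\<forall>\<^sub>F l in at_top. rms f l \<le> c + e"
      by (rule eventually_elim2[OF _ eventually_gt_at_top[of 0]])
         (use e assms(2) in \<open>auto simp: rms_def mean_square_nonneg ennreal_less_iff intro!: real_le_lsqrt\<close>)
  next
    fix y assume y: "ennreal (c\<^sup>2) < y" and *: "\<forall>e>0. \<forall>\<^sub>F l in at_top. rms f l \<le> c + e"
    show "\<forall>\<^sub>F l in at_top. ennreal (mean_square f l) < y"
    proof (cases y)
      case (real z)
      with y have z: "c\<^sup>2 < z" by (simp add: ennreal_less_iff)
      then have "c < sqrt z" by (simp add: real_less_rsqrt)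
      then have "\<forall>\<^sub>F l in at_top. rms f l \<le> c + (sqrt z - c) / 2" using * by simp
      then show ?thesis
      proof (rule eventually_elim2[OF _ eventually_gt_at_top[of 0]])
        fix l :: real assume "rms f l \<le> c + (sqrt z - c) / 2" "l > 0"
        then have "sqrt (mean_square f l) < sqrt z" using \<open>c < sqrt z\<close> unfolding rms_def by argo
        then show "ennreal (mean_square f l) < y" using \<open>l > 0\<close>
          by (simp add: real ennreal_less_iff mean_square_nonneg)
      qed
    qed simp
  qed
  finally show ?thesis .
qed

lemma besicovitch_seminorm_triangle:
  assumes "locally_p_integrable 2 f" "locally_p_integrable 2 g"
  shows "besicovitch_seminorm 2 (\<lambda>t. f t + g t) \<le> besicovitch_seminorm 2 f + besicovitch_seminorm 2 g"
proof (cases "besicovitch_seminorm 2 f"; cases "besicovitch_seminorm 2 g")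
  fix x y assume x: "x \<ge> 0" "besicovitch_seminorm 2 f = ennreal x"
    and y: "y \<ge> 0" "besicovitch_seminorm 2 g = ennreal y"
  have "besicovitch_seminorm 2 (\<lambda>t. f t + g t) \<le> ennreal (x + y)"
  proof (subst besicovitch_seminorm_le_iff, intro L2loc_add assms)
    show "x + y \<ge> 0" using x y by simp
    show "\<forall>e>0. \<forall>\<^sub>F l in at_top. rms (\<lambda>t. f t + g t) l \<le> x + y + e"
    proof safe
      fix e :: real assume "e > 0"
      then have "\<forall>\<^sub>F l in at_top. rms f l \<le> x + e / 2" "\<forall>\<^sub>F l in at_top. rms g l \<le> y + e / 2"
        using besicovitch_seminorm_le_iff[OF assms(1) x(1)] besicovitch_seminorm_le_iff[OF assms(2) y(1)]
          x y by auto
      then show "\<forall>\<^sub>F l in at_top. rms (\<lambda>t. f t + g t) l \<le> x + y + e"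
        using eventually_gt_at_top[of 0]
        by eventually_elim (use rms_triangle[OF assms] in fastforce)
    qed
  qed
  then show ?thesis using x y by simp
qed auto

lemma besicovitch_seminorm_cong:
  "(\<And>t. cmod (f t) = cmod (g t)) \<Longrightarrow> besicovitch_seminorm p f = besicovitch_seminorm p g"
  by (simp add: besicovitch_seminorm_def besicovitch_limsup_def)

lemma besicovitch_seminorm_diff_commute:
  "besicovitch_seminorm p (\<lambda>t. f t - g t) = besicovitch_seminorm p (\<lambda>t. g t - f t)"
  by (rule besicovitch_seminorm_cong) (rule norm_minus_commute)

lemma besicovitch_seminorm_diff_triangle:
  assumes "locally_p_integrable 2 f" "locally_p_integrable 2 g" "locally_p_integrable 2 h"
  shows "besicovitch_seminorm 2 (\<lambda>t. f t - h t) \<le>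
    besicovitch_seminorm 2 (\<lambda>t. f t - g t) + besicovitch_seminorm 2 (\<lambda>t. g t - h t)"
  using besicovitch_seminorm_triangle[OF L2loc_diff[OF assms(1,2)] L2loc_diff[OF assms(2,3)]] by simp

lemma besicovitch_seminorm_diff_less_add:
  assumes "locally_p_integrable 2 f" "locally_p_integrable 2 g" "locally_p_integrable 2 h"
    and "besicovitch_seminorm 2 (\<lambda>t. f t - g t) < ennreal a" "besicovitch_seminorm 2 (\<lambda>t. g t - h t) < ennreal b"
    and "a \<ge> 0" "b \<ge> 0"
  shows "besicovitch_seminorm 2 (\<lambda>t. f t - h t) < ennreal (a + b)"
  using besicovitch_seminorm_diff_triangle[OF assms(1-3)] add_strict_mono[OF assms(4,5)] assms(6,7)
  by (simp add: le_less_trans)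

lemma besicovitch_seminorm_bounded:
  assumes "u \<in> borel_measurable lebesgue" "\<And>t. cmod (u t) \<le> C"
  shows "besicovitch_seminorm 2 u \<le> ennreal C"
proof -
  have "C \<ge> 0" using assms(2)[of 0] norm_ge_zero order_trans by blast
  have "rms u l \<le> C" if "l > 0" for l
  proof -
    have "(LINT t:{-l..l}|lebesgue. (cmod (u t))\<^sup>2) \<le> (LINT t:{-l..l}|lebesgue. C\<^sup>2)"
      by (intro set_integral_mono L2loc_square_integrable[OF L2loc_bounded[OF assms]]
           set_integrable_const_Icc power_mono assms(2)) auto
    also have "\<dots> = 2 * l * C\<^sup>2" using that by (simp add: set_integral_const_Icc)
    finally have "mean_square u l \<le> C\<^sup>2"
      using that by (simp add: mean_square_def field_simps)
    then show ?thesis unfolding rms_def using \<open>C \<ge> 0\<close> by (intro real_le_lsqrt) auto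
  qed
  then show ?thesis
    by (subst besicovitch_seminorm_le_iff[OF L2loc_bounded[OF assms] \<open>C \<ge> 0\<close>])
       (auto intro!: eventually_mono[OF eventually_gt_at_top[of 0]] intro: add_increasing2)
qed

text \<open>
  The translation moves the interval by a fixed amount, which is negligible against its length in
  the limit.
\<close>

lemma besicovitch_seminorm_translation_le:
  assumes "locally_p_integrable 2 f"
  shows "besicovitch_seminorm 2 (\<lambda>t. f (t + \<tau>)) \<le> besicovitch_seminorm 2 f"
proof (cases "besicovitch_seminorm 2 f")
  case (real c)
  have "\<forall>\<^sub>F l in at_top. rms (\<lambda>t. f (t + \<tau>)) l \<le> c + e" if "e > 0" for e
  proof -
    have "\<forall>\<^sub>F l in at_top. rms f l \<le> c + e / 2"
      using besicovitch_seminorm_le_iff[OF assms real(1)] real that by auto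
    moreover have shift: "filterlim (\<lambda>l. l + \<bar>\<tau>\<bar>) at_top at_top"
      using filterlim_tendsto_add_at_top[OF tendsto_const[of "\<bar>\<tau>\<bar>"] filterlim_ident]
      by (simp add: add.commute)
    ultimately have "\<forall>\<^sub>F l in at_top. rms f (l + \<bar>\<tau>\<bar>) \<le> c + e / 2"
      by (rule eventually_compose_filterlim)
    moreover have "((\<lambda>l. sqrt (1 + \<bar>\<tau>\<bar> / l) * (c + e / 2)) \<longlongrightarrow> sqrt (1 + 0) * (c + e / 2)) at_top"
      by (intro tendsto_intros tendsto_divide_0[OF tendsto_const] filterlim_at_top_imp_at_infinity
          filterlim_ident)
    then have "\<forall>\<^sub>F l in at_top. sqrt (1 + \<bar>\<tau>\<bar> / l) * (c + e / 2) < c + e"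
      by (rule order_tendstoD) (use that in simp)
    ultimately show ?thesis using eventually_gt_at_top[of 0]
    proof eventually_elim
      case (elim l)
      have "rms (\<lambda>t. f (t + \<tau>)) l \<le> sqrt ((l + \<bar>\<tau>\<bar>) / l) * rms f (l + \<bar>\<tau>\<bar>)"
        by (rule rms_translation_le) (use assms elim in auto)
      also have "\<dots> \<le> sqrt ((l + \<bar>\<tau>\<bar>) / l) * (c + e / 2)"
        using elim by (intro mult_left_mono) auto
      also have "(l + \<bar>\<tau>\<bar>) / l = 1 + \<bar>\<tau>\<bar> / l" using elim by (simp add: field_simps)
      finally show ?case using elim by simp
    qed
  qed
  then show ?thesis
    using besicovitch_seminorm_le_iff[OF L2loc_translation[OF assms] real(1)] real by simp
qed auto

lemma besicovitch_seminorm_translation: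
  assumes "locally_p_integrable 2 f"
  shows "besicovitch_seminorm 2 (\<lambda>t. f (t + \<tau>)) = besicovitch_seminorm 2 f"
  using besicovitch_seminorm_translation_le[OF assms]
    besicovitch_seminorm_translation_le[OF L2loc_translation[OF assms, of \<tau>], of "-\<tau>"]
  by (intro antisym) auto

section \<open>Trigonometric polynomials\<close>

text \<open>
  From here on \<open>cis (\<mu> * t)\<close> stands for the exponential of frequency \<open>\<mu>\<close>, since its algebra is
  available as rewrite rules.
\<close>

lemma exp_eq_cis: "exp (\<i> * complex_of_real x) = cis x" "exp (- \<i> * complex_of_real x) = cis (- x)"
  by (simp_all add: cis_conv_exp)

lemma cis_measurable [measurable]: "(\<lambda>t. cis (\<mu> * t)) \<in> borel_measurable lebesgue"
  by (intro measurable_completion) (auto simp: cis_conv_exp intro!: borel_measurable_continuous_onI continuous_intros)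

lemma L2loc_mult_cis: "locally_p_integrable 2 f \<Longrightarrow> locally_p_integrable 2 (\<lambda>t. f t * cis (\<mu> * t))"
  using L2loc_mult_bounded[OF _ cis_measurable, of f \<mu> 1] by (simp add: mult.commute)

lemma L2loc_cis: "locally_p_integrable 2 (\<lambda>t. cis (\<mu> * t))"
  by (rule L2loc_bounded[OF cis_measurable]) auto

lemma L2loc_sum:
  assumes "\<And>i. i \<in> I \<Longrightarrow> locally_p_integrable 2 (f i)"
  shows "locally_p_integrable 2 (\<lambda>t. \<Sum>i\<in>I. f i t)"
  using assms
proof (induction I rule: infinite_finite_induct)
  case (insert i I)
  then show ?case by (simp add: L2loc_add)
qed (auto intro: L2loc_bounded[of _ 0])

lemma L2loc_trig_sum: "locally_p_integrable 2 (\<lambda>t. \<Sum>\<mu>\<in>F. c \<mu> * cis (\<mu> * t))"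
  by (intro L2loc_sum L2loc_cmult L2loc_cis)

lemma trig_sum_translation:
  "(\<Sum>\<mu>\<in>F. c \<mu> * cis (\<mu> * (t + \<tau>))) = (\<Sum>\<mu>\<in>F. (c \<mu> * cis (\<mu> * \<tau>)) * cis (\<mu> * t))"
  by (simp add: cis_mult distrib_left mult.assoc add.commute)

lemma trig_sum_seminorm_diff_le:
  "besicovitch_seminorm 2 (\<lambda>t. (\<Sum>\<mu>\<in>F. c \<mu> * cis (\<mu> * t)) - (\<Sum>\<mu>\<in>F. d \<mu> * cis (\<mu> * t))) \<le>
   ennreal (\<Sum>\<mu>\<in>F. cmod (c \<mu> - d \<mu>))"
proof -
  have "besicovitch_seminorm 2 (\<lambda>t. \<Sum>\<mu>\<in>F. (c \<mu> - d \<mu>) * cis (\<mu> * t)) \<le> ennreal (\<Sum>\<mu>\<in>F. cmod (c \<mu> - d \<mu>))"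
    by (intro besicovitch_seminorm_bounded sum_norm_le borel_measurable_sum borel_measurable_times
        cis_measurable) (auto simp: norm_mult)
  then show ?thesis by (simp add: left_diff_distrib sum_subtractf)
qed

lemma average_add:
  assumes "locally_p_integrable 2 f" "locally_p_integrable 2 g"
  shows "average (\<lambda>t. f t + g t) l = average f l + average g l"
  unfolding average_def
  by (subst set_integral_add(2)) (simp_all add: L2loc_integrable assms algebra_simps)

lemma average_cmult: "average (\<lambda>t. c * f t) l = c * average f l"
  by (simp add: average_def)

lemma average_diff:
  assumes "locally_p_integrable 2 f" "locally_p_integrable 2 g"
  shows "average (\<lambda>t. f t - g t) l = average f l - average g l"
  using average_add[OF assms(1) L2loc_cmult[OF assms(2), of "-1"], of l] average_cmult[of "-1" g l]
  by simp

lemma average_sum: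
  assumes "\<And>i. i \<in> I \<Longrightarrow> locally_p_integrable 2 (f i)"
  shows "average (\<lambda>t. \<Sum>i\<in>I. f i t) l = (\<Sum>i\<in>I. average (f i) l)"
  using assms
proof (induction I rule: infinite_finite_induct)
  case (insert i I)
  then show ?case by (simp add: average_add L2loc_sum)
qed (simp_all add: average_def set_lebesgue_integral_def)

text \<open>
  Orthogonality of the exponentials: for \<open>\<mu> \<noteq> 0\<close> the integral over \<open>{-l..l}\<close> is bounded by
  \<open>2/\<bar>\<mu>\<bar>\<close>, uniformly in \<open>l\<close>.
\<close>

lemma average_cis_tendsto:
  "((\<lambda>l. average (\<lambda>t. cis (\<mu> * t)) l) \<longlongrightarrow> (if \<mu> = 0 then 1 else 0)) at_top"
proof (cases "\<mu> = 0")
  case True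
  have "\<forall>\<^sub>F l in at_top. average (\<lambda>t. cis (\<mu> * t)) l = 1"
    using eventually_gt_at_top[of 0]
  proof eventually_elim
    case (elim l)
    then show ?case by (simp add: True average_def set_lebesgue_integral_def scaleR_conv_of_real)
  qed
  with True show ?thesis by (simp add: tendsto_eventually)
next
  case False
  have bound: "norm (average (\<lambda>t. cis (\<mu> * t)) l) \<le> 1 / \<bar>\<mu>\<bar> * (1 / l)" if "l > 0" for l
  proof -
    define G where "G = (\<lambda>t. cis (\<mu> * t) / (\<i> * of_real \<mu>))"
    have "(G has_vector_derivative cis (\<mu> * t)) (at t within S)" for t S
      unfolding G_def cis_conv_exp using False
      by (auto intro!: derivative_eq_intros has_vector_derivative_real_field simp: field_simps)
    then have "((\<lambda>t. cis (\<mu> * t)) has_integral (G l - G (-l))) {-l..l}"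
      using that by (intro fundamental_theorem_of_calculus) auto
    then have "(LINT t:{-l..l}|lebesgue. cis (\<mu> * t)) = G l - G (-l)"
      using set_lebesgue_integral_eq_integral(2)[OF L2loc_integrable[OF L2loc_cis]]
      by (metis integral_unique)
    also have "norm \<dots> \<le> norm (G l) + norm (G (-l))" by (rule norm_triangle_ineq4)
    also have "\<dots> = 2 / \<bar>\<mu>\<bar>" by (simp add: G_def norm_divide norm_mult)
    finally have "1 / (2 * l) * norm (LINT t:{-l..l}|lebesgue. cis (\<mu> * t)) \<le> 1 / (2 * l) * (2 / \<bar>\<mu>\<bar>)"
      using that by (intro mult_left_mono) auto
    then show ?thesis using that by (simp add: average_def norm_mult norm_divide mult.commute)
  qed
  have "((\<lambda>l. 1 / \<bar>\<mu>\<bar> * (1 / l)) \<longlongrightarrow> 1 / \<bar>\<mu>\<bar> * 0) at_top"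
    by (intro tendsto_intros tendsto_divide_0[OF tendsto_const] filterlim_at_top_imp_at_infinity
        filterlim_ident)
  then have "((\<lambda>l. average (\<lambda>t. cis (\<mu> * t)) l) \<longlongrightarrow> 0) at_top"
    by (intro Lim_null_comparison[OF eventually_mono[OF eventually_gt_at_top[of 0] bound]]) auto
  with False show ?thesis by simp
qed

lemma average_trig_sum_tendsto:
  assumes "finite F"
  shows "((\<lambda>l. average (\<lambda>t. (\<Sum>\<mu>\<in>F. c \<mu> * cis (\<mu> * t)) * cis (- \<nu> * t)) l) \<longlongrightarrow>
     (if \<nu> \<in> F then c \<nu> else 0)) at_top"
proof -
  have eq: "(\<lambda>t. (\<Sum>\<mu>\<in>F. c \<mu> * cis (\<mu> * t)) * cis (- \<nu> * t)) = 
     (\<lambda>t. \<Sum>\<mu>\<in>F. c \<mu> * cis ((\<mu> - \<nu>) * t))"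
    by (simp add: fun_eq_iff sum_distrib_right cis_mult mult.assoc left_diff_distrib)
  have "((\<lambda>l. \<Sum>\<mu>\<in>F. c \<mu> * average (\<lambda>t. cis ((\<mu> - \<nu>) * t)) l) \<longlongrightarrow>
      (\<Sum>\<mu>\<in>F. c \<mu> * (if \<mu> - \<nu> = 0 then 1 else 0))) at_top"
    by (intro tendsto_intros average_cis_tendsto)
  also have "(\<Sum>\<mu>\<in>F. c \<mu> * (if \<mu> - \<nu> = 0 then 1 else 0)) = (\<Sum>\<mu>\<in>F. if \<mu> = \<nu> then c \<mu> else 0)"
    by (intro sum.cong) auto
  also have "\<dots> = (if \<nu> \<in> F then c \<nu> else 0)" using assms by simp
  finally show ?thesis
    unfolding eq by (simp add: average_sum[OF L2loc_cmult[OF L2loc_cis]] average_cmult)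
qed

text \<open>
  Collecting equal frequencies lets a trigonometric polynomial be indexed by the finite set of its
  frequencies, which makes its coefficients well determined.
\<close>

lemma trig_polynomial_iff:
  "trig_polynomial P \<longleftrightarrow> (\<exists>F c. finite F \<and> P = (\<lambda>t. \<Sum>\<mu>\<in>F. c \<mu> * cis (\<mu> * t)))"
proof
  assume "trig_polynomial P"
  then obtain a \<omega> and n :: nat where P: "P = (\<lambda>t. \<Sum>j=1..n. a j * cis (\<omega> j * t))"
    unfolding trig_polynomial_def exp_eq_cis by auto
  have "P t = (\<Sum>\<mu>\<in>\<omega> ` {1..n}. (\<Sum>j | j \<in> {1..n} \<and> \<omega> j = \<mu>. a j) * cis (\<mu> * t))" for t
    unfolding P by (subst sum.image_gen[where g = \<omega>]) (auto simp: sum_distrib_right intro!: sum.cong)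
  then show "\<exists>F c. finite F \<and> P = (\<lambda>t. \<Sum>\<mu>\<in>F. c \<mu> * cis (\<mu> * t))"
    by (intro exI[of _ "\<omega> ` {1..n}"] exI[of _ "\<lambda>\<mu>. \<Sum>j | j \<in> {1..n} \<and> \<omega> j = \<mu>. a j"]) auto
next
  assume "\<exists>F c. finite F \<and> P = (\<lambda>t. \<Sum>\<mu>\<in>F. c \<mu> * cis (\<mu> * t))"
  then obtain F c where F: "finite F" and P: "P = (\<lambda>t. \<Sum>\<mu>\<in>F. c \<mu> * cis (\<mu> * t))" by blast
  obtain \<omega> where \<omega>: "bij_betw \<omega> {1..card F} F" using ex_bij_betw_nat_finite_1[OF F] by blast
  have "P = (\<lambda>t. \<Sum>j=1..card F. c (\<omega> j) * cis (\<omega> j * t))"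
    unfolding P using sum.reindex_bij_betw[OF \<omega>, where g = "\<lambda>\<mu>. c \<mu> * cis (\<mu> * _)"]
    by (intro ext) (rule sym)
  then show "trig_polynomial P"
    unfolding trig_polynomial_def exp_eq_cis 
    by (intro exI[of _ "card F"] exI[of _ "c \<circ> \<omega>"] exI[of _ \<omega>]) simp
qed

section \<open>Fourier coefficients\<close>

lemma besicovitch_L2loc: "f \<in> besicovitch 2 \<Longrightarrow> locally_p_integrable 2 f"
  by (simp add: besicovitch_def)

lemma besicovitch_approx:
  assumes "f \<in> besicovitch 2" "\<epsilon> > 0"
  obtains F c where "finite F"
    "besicovitch_seminorm 2 (\<lambda>t. f t - (\<Sum>\<mu>\<in>F. c \<mu> * cis (\<mu> * t))) < ennreal \<epsilon>"
  using assms unfolding besicovitch_def trig_polynomial_iff by blast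

lemma besicovitchI:
  assumes "locally_p_integrable 2 f"
    and "\<And>\<epsilon>. \<epsilon> > 0 \<Longrightarrow> \<exists>F c. finite F \<and>
      besicovitch_seminorm 2 (\<lambda>t. f t - (\<Sum>\<mu>\<in>F. c \<mu> * cis (\<mu> * t))) < ennreal \<epsilon>"
  shows "f \<in> besicovitch 2"
  using assms unfolding besicovitch_def trig_polynomial_iff by blast

lemma besicovitch_translation:
  assumes "f \<in> besicovitch 2"
  shows "(\<lambda>t. f (t + \<tau>)) \<in> besicovitch 2"
proof (rule besicovitchI)
  note f = besicovitch_L2loc[OF assms]
  show "locally_p_integrable 2 (\<lambda>t. f (t + \<tau>))" by (rule L2loc_translation[OF f])
  fix \<epsilon> :: real assume "\<epsilon> > 0"
  from besicovitch_approx[OF assms this] obtain F c where F: "finite F"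
    and le: "besicovitch_seminorm 2 (\<lambda>t. f t - (\<Sum>\<mu>\<in>F. c \<mu> * cis (\<mu> * t))) < ennreal \<epsilon>" .
  have "besicovitch_seminorm 2 (\<lambda>t. f (t + \<tau>) - (\<Sum>\<mu>\<in>F. (c \<mu> * cis (\<mu> * \<tau>)) * cis (\<mu> * t))) =
      besicovitch_seminorm 2 (\<lambda>t. f t - (\<Sum>\<mu>\<in>F. c \<mu> * cis (\<mu> * t)))"
    using besicovitch_seminorm_translation[OF L2loc_diff[OF f L2loc_trig_sum[where c = c and F = F]], of \<tau>]
    by (simp only: trig_sum_translation)
  with F le show "\<exists>F c. finite F \<and>
      besicovitch_seminorm 2 (\<lambda>t. f (t + \<tau>) - (\<Sum>\<mu>\<in>F. c \<mu> * cis (\<mu> * t))) < ennreal \<epsilon>"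
    by (intro exI[of _ F] exI[of _ "\<lambda>\<mu>. c \<mu> * cis (\<mu> * \<tau>)"]) simp
qed

lemma rms_eventually_le:
  assumes "locally_p_integrable 2 f" "besicovitch_seminorm 2 f < ennreal \<epsilon>"
  shows "\<forall>\<^sub>F l in at_top. rms f l \<le> \<epsilon>"
proof (cases "besicovitch_seminorm 2 f")
  case (real c)
  then have "c < \<epsilon>" using assms(2) by (simp add: ennreal_less_iff)
  moreover have "\<forall>e>0. \<forall>\<^sub>F l in at_top. rms f l \<le> c + e"
    using besicovitch_seminorm_le_iff[OF assms(1) real(1)] real by simp
  ultimately show ?thesis by (metis add.commute diff_add_cancel diff_gt_0_iff_gt)
qed (use assms in auto)

lemma rms_mult_cis: "rms (\<lambda>t. f t * cis (\<mu> * t)) l = rms f l"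
  by (simp add: rms_def mean_square_def norm_mult)

lemma average_mult_cis_diff_le:
  assumes "locally_p_integrable 2 f" "locally_p_integrable 2 g" "l > 0"
  shows "cmod (average (\<lambda>t. f t * cis (\<mu> * t)) l - average (\<lambda>t. g t * cis (\<mu> * t)) l) \<le> 
    rms (\<lambda>t. f t - g t) l"
proof -
  have "average (\<lambda>t. f t * cis (\<mu> * t)) l - average (\<lambda>t. g t * cis (\<mu> * t)) l =
     average (\<lambda>t. (f t - g t) * cis (\<mu> * t)) l"
    by (simp add: average_diff[symmetric] L2loc_mult_cis assms left_diff_distrib)
  then show ?thesis
    using cmod_average_le_rms[OF L2loc_mult_cis[OF L2loc_diff[OF assms(1,2)]] assms(3)]
    by (simp add: rms_mult_cis)
qed

text \<open>
  Take approximations to within \<open>1/(n + 1)\<close>: their limits form a Cauchy sequence, whose limit is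
  approached by \<open>h\<close>. This gives mean values to functions that trigonometric polynomials approximate.
\<close>

lemma convergent_if_approximable:
  fixes h :: "'a \<Rightarrow> 'b::banach"
  assumes "F \<noteq> bot"
    and approx: "\<And>\<epsilon>::real. \<epsilon> > 0 \<Longrightarrow> \<exists>g L. (g \<longlongrightarrow> L) F \<and> (\<forall>\<^sub>F x in F. norm (h x - g x) \<le> \<epsilon>)"
  shows "\<exists>L. (h \<longlongrightarrow> L) F"
proof -
  have "\<forall>n::nat. \<exists>g L. (g \<longlongrightarrow> L) F \<and> (\<forall>\<^sub>F x in F. norm (h x - g x) \<le> 1 / real (Suc n))"
    using approx by simp
  then obtain g L where g: "\<And>n::nat. (g n \<longlongrightarrow> L n) F"
    and near: "\<And>n. \<forall>\<^sub>F x in F. norm (h x - g n x) \<le> 1 / real (Suc n)"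
    by metis
  have L: "norm (L m - L n) \<le> 1 / real (Suc m) + 1 / real (Suc n)" for m n
  proof (rule tendsto_upperbound[OF tendsto_norm[OF tendsto_diff[OF g g]] _ assms(1)])
    show "\<forall>\<^sub>F x in F. norm (g m x - g n x) \<le> 1 / real (Suc m) + 1 / real (Suc n)"
      using near[of m] near[of n]
      by eventually_elim (smt (verit, best) norm_minus_commute norm_diff_triangle_le)
  qed
  have "Cauchy L"
  proof (rule metric_CauchyI)
    fix e :: real assume "e > 0"
    then obtain N where N: "1 / real (Suc N) < e / 2"
      using nat_approx_posE[of "e / 2"] by auto
    have "dist (L m) (L n) < e" if "m \<ge> N" "n \<ge> N" for m n
    proof -
      have "1 / real (Suc m) \<le> 1 / real (Suc N)" "1 / real (Suc n) \<le> 1 / real (Suc N)"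
        using that by (auto intro!: divide_left_mono)
      with L[of m n] N show ?thesis by (simp add: dist_norm)
    qed
    then show "\<exists>M. \<forall>m\<ge>M. \<forall>n\<ge>M. dist (L m) (L n) < e" by blast
  qed
  then obtain K where K: "L \<longlonglongrightarrow> K" using Cauchy_convergent_iff convergent_def by blast
  have "(h \<longlongrightarrow> K) F"
  proof (rule tendstoI)
    fix e :: real assume "e > 0"
    then have "\<forall>\<^sub>F n in sequentially. dist (L n) K < e / 3" by (intro tendstoD[OF K]) simp
    moreover have "(\<lambda>n. 1 / real (Suc n)) \<longlonglongrightarrow> 0"
      using LIMSEQ_inverse_real_of_nat by (simp add: inverse_eq_divide)
    then have "\<forall>\<^sub>F n in sequentially. 1 / real (Suc n) < e / 3"
      by (rule order_tendstoD) (use \<open>e > 0\<close> in simp)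
    ultimately have "\<forall>\<^sub>F n in sequentially. dist (L n) K < e / 3 \<and> 1 / real (Suc n) < e / 3"
      by eventually_elim simp
    then obtain n where n: "dist (L n) K < e / 3" "1 / real (Suc n) < e / 3"
      using eventually_happens'[OF sequentially_bot] by blast
    have "\<forall>\<^sub>F x in F. dist (g n x) (L n) < e / 3" using \<open>e > 0\<close> by (intro tendstoD[OF g]) simp
    with near[of n] show "\<forall>\<^sub>F x in F. dist (h x) K < e"
    proof eventually_elim
      case (elim x)
      have "dist (h x) K \<le> dist (h x) (g n x) + dist (g n x) (L n) + dist (L n) K"
        by (smt (verit) dist_triangle)
      with elim n show ?case by (simp add: dist_norm)
    qed
  qed
  then show ?thesis ..
qed

lemma fourier_coeff_eq: "fourier_coeff f \<mu> = Lim at_top (average (\<lambda>t. f t * cis (- \<mu> * t)))"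
  by (simp add: fourier_coeff_def mean_value_def average_def[abs_def] cis_conv_exp)

text \<open>
  The mean value is defined with \<open>Lim\<close>, which is arbitrary when there is no limit; for an element
  of \<open>B\<^sup>2\<close> the limit exists because it exists for the approximating polynomials.
\<close>

lemma fourier_coeff_tendsto:
  assumes "f \<in> besicovitch 2"
  shows "(average (\<lambda>t. f t * cis (- \<mu> * t)) \<longlongrightarrow> fourier_coeff f \<mu>) at_top"
proof -
  note f = besicovitch_L2loc[OF assms]
  have "\<exists>L. (average (\<lambda>t. f t * cis (- \<mu> * t)) \<longlongrightarrow> L) at_top"
  proof (rule convergent_if_approximable)
    fix \<epsilon> :: real assume "\<epsilon> > 0"
    from besicovitch_approx[OF assms this] obtain F c where F: "finite F"
      and le: "besicovitch_seminorm 2 (\<lambda>t. f t - (\<Sum>\<mu>\<in>F. c \<mu> * cis (\<mu> * t))) < ennreal \<epsilon>" .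
    show "\<exists>g L. (g \<longlongrightarrow> L) at_top \<and> (\<forall>\<^sub>F l in at_top. 
        norm (average (\<lambda>t. f t * cis (- \<mu> * t)) l - g l) \<le> \<epsilon>)"
    proof (intro exI conjI, rule average_trig_sum_tendsto[OF F])
      show "\<forall>\<^sub>F l in at_top. norm (average (\<lambda>t. f t * cis (- \<mu> * t)) l - 
          average (\<lambda>t. (\<Sum>\<mu>\<in>F. c \<mu> * cis (\<mu> * t)) * cis (- \<mu> * t)) l) \<le> \<epsilon>"
        using rms_eventually_le[OF L2loc_diff[OF f L2loc_trig_sum] le] eventually_gt_at_top[of 0]
        by eventually_elim (rule order_trans[OF average_mult_cis_diff_le[OF f L2loc_trig_sum]])
    qed
  qed simp
  then show ?thesis
    unfolding fourier_coeff_eq using tendsto_Lim trivial_limit_at_top_linorder by metis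
qed

lemma fourier_coeff_diff_le:
  assumes "f \<in> besicovitch 2" "g \<in> besicovitch 2"
    and "besicovitch_seminorm 2 (\<lambda>t. f t - g t) < ennreal \<epsilon>"
  shows "cmod (fourier_coeff f \<mu> - fourier_coeff g \<mu>) \<le> \<epsilon>"
proof (rule tendsto_upperbound[OF tendsto_norm[OF tendsto_diff[OF 
      fourier_coeff_tendsto[OF assms(1)] fourier_coeff_tendsto[OF assms(2)]]]])
  note fg = assms(1,2)[THEN besicovitch_L2loc]
  show "\<forall>\<^sub>F l in at_top. cmod (average (\<lambda>t. f t * cis (- \<mu> * t)) l - 
        average (\<lambda>t. g t * cis (- \<mu> * t)) l) \<le> \<epsilon>"
    using rms_eventually_le[OF L2loc_diff[OF fg] assms(3)] eventually_gt_at_top[of 0]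
    by eventually_elim (rule order_trans[OF average_mult_cis_diff_le[OF fg]])
qed simp

lemma besicovitch_seminorm_zero [simp]: "besicovitch_seminorm 2 (\<lambda>_. 0) = 0"
  using besicovitch_seminorm_bounded[of "\<lambda>_. 0" 0] by simp

lemma trig_sum_besicovitch:
  "finite F \<Longrightarrow> (\<lambda>t. \<Sum>\<mu>\<in>F. c \<mu> * cis (\<mu> * t)) \<in> besicovitch 2"
  by (intro besicovitchI exI[of _ F] exI[of _ c] conjI L2loc_trig_sum) auto

lemma fourier_coeff_trig_sum:
  assumes "finite F"
  shows "fourier_coeff (\<lambda>t. \<Sum>\<mu>\<in>F. c \<mu> * cis (\<mu> * t)) \<nu> = (if \<nu> \<in> F then c \<nu> else 0)"
  unfolding fourier_coeff_eq
  by (rule tendsto_Lim[OF trivial_limit_at_top_linorder average_trig_sum_tendsto[OF assms]])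

text \<open>
  Clear for a trigonometric polynomial; both sides depend continuously on \<open>f\<close>, since the seminorm
  is invariant under translations.
\<close>

lemma fourier_coeff_translation:
  assumes "f \<in> besicovitch 2"
  shows "fourier_coeff (\<lambda>t. f (t + \<tau>)) \<mu> = fourier_coeff f \<mu> * cis (\<mu> * \<tau>)"
proof -
  note f = besicovitch_L2loc[OF assms]
  have "cmod (fourier_coeff (\<lambda>t. f (t + \<tau>)) \<mu> - fourier_coeff f \<mu> * cis (\<mu> * \<tau>)) \<le> \<epsilon>" if "\<epsilon> > 0" for \<epsilon>
  proof -
    from besicovitch_approx[OF assms, of "\<epsilon> / 2"] that obtain F c where F: "finite F"
      and le: "besicovitch_seminorm 2 (\<lambda>t. f t - (\<Sum>\<mu>\<in>F. c \<mu> * cis (\<mu> * t))) < ennreal (\<epsilon> / 2)" by auto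
    define P where "P = (\<lambda>t. \<Sum>\<mu>\<in>F. c \<mu> * cis (\<mu> * t))"
    have P: "P \<in> besicovitch 2" unfolding P_def by (rule trig_sum_besicovitch[OF F])
    have P\<tau>: "(\<lambda>t. P (t + \<tau>)) = (\<lambda>t. \<Sum>\<mu>\<in>F. (c \<mu> * cis (\<mu> * \<tau>)) * cis (\<mu> * t))"
      unfolding P_def trig_sum_translation ..
    have "fourier_coeff (\<lambda>t. P (t + \<tau>)) \<mu> = fourier_coeff P \<mu> * cis (\<mu> * \<tau>)"
      unfolding P\<tau> fourier_coeff_trig_sum[OF F] by (simp add: P_def fourier_coeff_trig_sum[OF F])
    moreover have "cmod (fourier_coeff f \<mu> - fourier_coeff P \<mu>) \<le> \<epsilon> / 2"
      by (rule fourier_coeff_diff_le[OF assms P]) (use le in \<open>simp add: P_def\<close>)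
    moreover have "cmod (fourier_coeff (\<lambda>t. f (t + \<tau>)) \<mu> - fourier_coeff (\<lambda>t. P (t + \<tau>)) \<mu>) \<le> \<epsilon> / 2"
      by (rule fourier_coeff_diff_le[OF besicovitch_translation[OF assms] besicovitch_translation[OF P]])
         (use le besicovitch_seminorm_translation[OF L2loc_diff[OF f besicovitch_L2loc[OF P]], of \<tau>]
           in \<open>simp add: P_def\<close>)
    moreover have "cmod (fourier_coeff f \<mu> * cis (\<mu> * \<tau>) - fourier_coeff P \<mu> * cis (\<mu> * \<tau>)) =
        cmod (fourier_coeff f \<mu> - fourier_coeff P \<mu>)"
      by (simp add: left_diff_distrib[symmetric] norm_mult)
    ultimately show ?thesis
      by (smt (verit, best) norm_diff_triangle_le norm_minus_commute field_sum_of_halves)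
  qed
  then have "cmod (fourier_coeff (\<lambda>t. f (t + \<tau>)) \<mu> - fourier_coeff f \<mu> * cis (\<mu> * \<tau>)) \<le> 0"
    by (metis field_le_epsilon add_0)
  then show ?thesis by simp
qed

section \<open>Convergence of Fourier sums\<close>

lemma cmod_add_sq_ge: "(cmod u)\<^sup>2 + 2 * Re (u * cnj v) \<le> (cmod (u + v))\<^sup>2"
proof -
  have "(cmod (u + v))\<^sup>2 = (cmod u)\<^sup>2 + (cmod v)\<^sup>2 + 2 * Re (u * cnj v)"
    unfolding cmod_power2 by (simp add: power2_eq_square algebra_simps)
  then show ?thesis by simp
qed

text \<open>
  The mean square of \<open>q\<close> is dropped from the expansion, so only the cross term has to be controlled
  in the limit.
\<close>

lemma mean_square_add_ge:
  assumes "locally_p_integrable 2 h" "locally_p_integrable 2 q" "locally_p_integrable 2 (\<lambda>t. cnj (q t))" "l > 0"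
  shows "mean_square h l + 2 * Re (average (\<lambda>t. h t * cnj (q t)) l) \<le> mean_square (\<lambda>t. h t + q t) l"
proof -
  have int: "set_integrable lebesgue {-l..l} (\<lambda>t. h t * cnj (q t))"
    by (rule L2loc_product_integrable[OF assms(1,3)])
  have Re_int: "set_integrable lebesgue {-l..l} (\<lambda>t. Re (h t * cnj (q t)))"
    using int unfolding set_integrable_def by (auto dest: integrable_Re simp: scaleR_conv_of_real)
  have Re: "Re (LINT t:{-l..l}|lebesgue. h t * cnj (q t)) = (LINT t:{-l..l}|lebesgue. Re (h t * cnj (q t)))"
    using int unfolding set_integrable_def set_lebesgue_integral_def
    by (subst integral_Re[symmetric]) (auto intro!: Bochner_Integration.integral_cong)
  have "(LINT t:{-l..l}|lebesgue. (cmod (h t))\<^sup>2) + 2 * (LINT t:{-l..l}|lebesgue. Re (h t * cnj (q t))) =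
        (LINT t:{-l..l}|lebesgue. (cmod (h t))\<^sup>2 + 2 * Re (h t * cnj (q t)))"
    by (subst set_integral_add(2)) (auto intro!: L2loc_square_integrable assms set_integrable_mult_right
        Re_int simp del: times_complex.sel)
  also have "\<dots> \<le> (LINT t:{-l..l}|lebesgue. (cmod (h t + q t))\<^sup>2)"
    by (intro set_integral_mono set_integral_add set_integrable_mult_right impI
        L2loc_square_integrable L2loc_add assms cmod_add_sq_ge Re_int)
  finally have "1 / (2 * l) * ((LINT t:{-l..l}|lebesgue. (cmod (h t))\<^sup>2) + 
      2 * Re (LINT t:{-l..l}|lebesgue. h t * cnj (q t))) \<le> mean_square (\<lambda>t. h t + q t) l"
    unfolding mean_square_def Re using assms(4) by (intro mult_left_mono) auto
  then show ?thesis using assms(4)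
    by (simp add: mean_square_def average_def algebra_simps add_divide_distrib)
qed

definition fourier_sum :: "(real \<Rightarrow> complex) \<Rightarrow> real set \<Rightarrow> real \<Rightarrow> complex" where
  "fourier_sum f F t = (\<Sum>\<mu>\<in>F. fourier_coeff f \<mu> * cis (\<mu> * t))"

lemma L2loc_fourier_sum: "locally_p_integrable 2 (fourier_sum f F)"
  unfolding fourier_sum_def[abs_def] by (rule L2loc_trig_sum)

text \<open>
  The remainder \<open>h\<close> of the Fourier sum is orthogonal in the mean to the exponentials with exponents
  in \<open>F\<close>. Any other polynomial \<open>P\<close> with these exponents differs from the Fourier sum by a
  combination \<open>q\<close> of them, and the cross term of \<open>f - P = h + q\<close> tends to 0.
\<close>

lemma fourier_sum_best_approximation:
  assumes "f \<in> besicovitch 2" "finite F"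
  shows "besicovitch_seminorm 2 (\<lambda>t. f t - fourier_sum f F t) \<le>
         besicovitch_seminorm 2 (\<lambda>t. f t - (\<Sum>\<mu>\<in>F. c \<mu> * cis (\<mu> * t)))"
proof -
  note f = besicovitch_L2loc[OF assms(1)]
  define h where "h = (\<lambda>t. f t - fourier_sum f F t)"
  define d where "d \<mu> = fourier_coeff f \<mu> - c \<mu>" for \<mu>
  define q where "q = (\<lambda>t. \<Sum>\<mu>\<in>F. d \<mu> * cis (\<mu> * t))"
  define k where "k = (\<lambda>t. f t - (\<Sum>\<mu>\<in>F. c \<mu> * cis (\<mu> * t)))"
  have k: "k = (\<lambda>t. h t + q t)"
    by (simp add: k_def h_def q_def d_def fourier_sum_def left_diff_distrib sum_subtractf)
  have cnj_q: "cnj (q t) = (\<Sum>\<mu>\<in>F. cnj (d \<mu>) * cis (- \<mu> * t))" for t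
    by (simp add: q_def cis_cnj)
  have h: "locally_p_integrable 2 h" unfolding h_def by (intro L2loc_diff f L2loc_fourier_sum)
  have q: "locally_p_integrable 2 q" unfolding q_def by (rule L2loc_trig_sum)
  have q': "locally_p_integrable 2 (\<lambda>t. cnj (q t))"
    using L2loc_trig_sum[of "\<lambda>\<mu>. cnj (d (- \<mu>))" "uminus ` F"]
    by (simp add: cnj_q sum.reindex inj_on_def)
  have kL: "locally_p_integrable 2 k" unfolding k by (intro L2loc_add h q)
  have orth: "((\<lambda>l. average (\<lambda>t. h t * cis (- \<mu> * t)) l) \<longlongrightarrow> 0) at_top" if "\<mu> \<in> F" for \<mu>
  proof -
    have "((\<lambda>l. average (\<lambda>t. f t * cis (- \<mu> * t)) l - average (\<lambda>t. fourier_sum f F t * cis (- \<mu> * t)) l) 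
        \<longlongrightarrow> fourier_coeff f \<mu> - (if \<mu> \<in> F then fourier_coeff f \<mu> else 0)) at_top"
      unfolding fourier_sum_def
      by (intro tendsto_diff fourier_coeff_tendsto average_trig_sum_tendsto assms)
    moreover have "average (\<lambda>t. h t * cis (- \<mu> * t)) l = average (\<lambda>t. f t * cis (- \<mu> * t)) l - 
        average (\<lambda>t. fourier_sum f F t * cis (- \<mu> * t)) l" for l
      unfolding h_def left_diff_distrib by (intro average_diff L2loc_mult_cis f L2loc_fourier_sum)
    ultimately show ?thesis using that by simp
  qed
  have "((\<lambda>l. \<Sum>\<mu>\<in>F. cnj (d \<mu>) * average (\<lambda>t. h t * cis (- \<mu> * t)) l) \<longlongrightarrow> (\<Sum>\<mu>\<in>F. cnj (d \<mu>) * 0)) at_top"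
    by (intro tendsto_intros orth)
  moreover have "(\<lambda>t. h t * cnj (q t)) = (\<lambda>t. \<Sum>\<mu>\<in>F. cnj (d \<mu>) * (h t * cis (- \<mu> * t)))"
    by (simp add: cnj_q sum_distrib_left mult_ac)
  then have "average (\<lambda>t. h t * cnj (q t)) l = 
      (\<Sum>\<mu>\<in>F. cnj (d \<mu>) * average (\<lambda>t. h t * cis (- \<mu> * t)) l)" for l
    by (simp only: average_sum[OF L2loc_cmult[OF L2loc_mult_cis[OF h]]] average_cmult)
  ultimately have lim: "((\<lambda>l. average (\<lambda>t. h t * cnj (q t)) l) \<longlongrightarrow> 0) at_top" by simp
  have "besicovitch_seminorm 2 h \<le> besicovitch_seminorm 2 k"
  proof (cases "besicovitch_seminorm 2 k")
    case (real C)
    have "\<forall>\<^sub>F l in at_top. rms h l \<le> C + e" if "e > 0" for e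
    proof -
      have "\<forall>\<^sub>F l in at_top. rms k l \<le> C + e / 2"
        using besicovitch_seminorm_le_iff[OF kL real(1)] real that by simp
      moreover have "\<forall>\<^sub>F l in at_top. cmod (average (\<lambda>t. h t * cnj (q t)) l) < (e / 2)\<^sup>2 / 2"
        using tendstoD[OF lim, of "(e / 2)\<^sup>2 / 2"] that by simp
      ultimately show ?thesis using eventually_gt_at_top[of 0]
      proof eventually_elim
        case (elim l)
        have "\<bar>Re (average (\<lambda>t. h t * cnj (q t)) l)\<bar> < (e / 2)\<^sup>2 / 2"
          using abs_Re_le_cmod elim(2) by (rule le_less_trans)
        then have "mean_square h l \<le> mean_square k l + (e / 2)\<^sup>2"
          using mean_square_add_ge[OF h q q' elim(3)] unfolding k by linarith
        also have "\<dots> \<le> (C + e / 2)\<^sup>2 + (e / 2)\<^sup>2"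
          unfolding rms_sq[OF elim(3), symmetric] using elim rms_nonneg[OF elim(3)]
          by (intro add_right_mono power_mono) auto
        also have "\<dots> \<le> (C + e)\<^sup>2"
          using real(1) that by (simp add: power2_eq_square field_simps)
        finally show ?case unfolding rms_def
          using real(1) that by (intro real_le_lsqrt) auto
      qed
    qed
    then show ?thesis using besicovitch_seminorm_le_iff[OF h real(1)] real by simp
  qed auto
  then show ?thesis by (simp add: h_def k_def)
qed

text \<open>
  An approximating polynomial with exponents in \<open>F0\<close> also competes, with zero coefficients added,
  against the Fourier sum over any larger set.
\<close>

lemma fourier_sums_converge:
  assumes "f \<in> besicovitch 2" "\<epsilon> > 0"
  obtains F0 where "finite F0"
    "\<And>F. finite F \<Longrightarrow> F0 \<subseteq> F \<Longrightarrow> besicovitch_seminorm 2 (\<lambda>t. f t - fourier_sum f F t) < ennreal \<epsilon>"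
proof -
  from besicovitch_approx[OF assms] obtain F0 c where F0: "finite F0"
    and le: "besicovitch_seminorm 2 (\<lambda>t. f t - (\<Sum>\<mu>\<in>F0. c \<mu> * cis (\<mu> * t))) < ennreal \<epsilon>" .
  show thesis
  proof (rule that[OF F0])
    fix F assume F: "finite F" "F0 \<subseteq> F"
    define c' where "c' \<mu> = (if \<mu> \<in> F0 then c \<mu> else 0)" for \<mu>
    have "(\<Sum>\<mu>\<in>F0. c \<mu> * cis (\<mu> * t)) = (\<Sum>\<mu>\<in>F. c' \<mu> * cis (\<mu> * t))" for t
      using F by (intro sum.mono_neutral_cong_left) (auto simp: c'_def)
    with le show "besicovitch_seminorm 2 (\<lambda>t. f t - fourier_sum f F t) < ennreal \<epsilon>"
      using fourier_sum_best_approximation[OF assms(1) F(1), of c'] by simp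
  qed
qed

section \<open>Completeness\<close>

lemma besicovitch_seminorm_finite:
  assumes "f \<in> besicovitch 2"
  shows "besicovitch_seminorm 2 f < \<infinity>"
proof -
  note f = besicovitch_L2loc[OF assms]
  from besicovitch_approx[OF assms zero_less_one] obtain F c where F: "finite F"
    and le: "besicovitch_seminorm 2 (\<lambda>t. f t - (\<Sum>\<mu>\<in>F. c \<mu> * cis (\<mu> * t))) < ennreal 1" .
  have "besicovitch_seminorm 2 f \<le> besicovitch_seminorm 2 (\<lambda>t. f t - (\<Sum>\<mu>\<in>F. c \<mu> * cis (\<mu> * t))) +
      besicovitch_seminorm 2 (\<lambda>t. \<Sum>\<mu>\<in>F. c \<mu> * cis (\<mu> * t))"
    using besicovitch_seminorm_triangle[OF L2loc_diff[OF f L2loc_trig_sum[where c = c and F = F]] 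
        L2loc_trig_sum[where c = c and F = F]] by simp
  also have "besicovitch_seminorm 2 (\<lambda>t. \<Sum>\<mu>\<in>F. c \<mu> * cis (\<mu> * t)) \<le> ennreal (\<Sum>\<mu>\<in>F. cmod (c \<mu>))"
    by (intro besicovitch_seminorm_bounded sum_norm_le borel_measurable_sum borel_measurable_times
        cis_measurable) (auto simp: norm_mult)
  finally show ?thesis
    using le by (auto simp: top_unique less_top[symmetric] simp del: ennreal_1 intro: le_less_trans)
qed

lemma besicovitch_seminorm_diff_finite:
  assumes "f \<in> besicovitch 2" "g \<in> besicovitch 2"
  shows "besicovitch_seminorm 2 (\<lambda>t. f t - g t) < \<infinity>"
proof -
  note fg = assms[THEN besicovitch_L2loc]
  have "besicovitch_seminorm 2 (\<lambda>t. f t - g t) \<le> besicovitch_seminorm 2 f + besicovitch_seminorm 2 g"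
    using besicovitch_seminorm_triangle[OF fg(1) L2loc_cmult[OF fg(2), of "-1"]]
      besicovitch_seminorm_cong[of "\<lambda>t. - g t" g] by simp
  then show ?thesis
    using assms[THEN besicovitch_seminorm_finite] by (auto intro: le_less_trans)
qed

text \<open>
  Only the local integrability of \<open>g\<close> has to be known beforehand; this is how the glued function
  below is recognised as an element of \<open>B\<^sup>2\<close>.
\<close>

lemma besicovitch_closed:
  assumes "locally_p_integrable 2 g"
    and "\<And>\<epsilon>. \<epsilon> > 0 \<Longrightarrow> \<exists>f\<in>besicovitch 2. besicovitch_seminorm 2 (\<lambda>t. g t - f t) < ennreal \<epsilon>"
  shows "g \<in> besicovitch 2"
proof (rule besicovitchI[OF assms(1)])
  fix \<epsilon> :: real assume "\<epsilon> > 0"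
  with assms(2)[of "\<epsilon> / 2"] obtain f where f: "f \<in> besicovitch 2" 
    "besicovitch_seminorm 2 (\<lambda>t. g t - f t) < ennreal (\<epsilon> / 2)" by auto
  from besicovitch_approx[OF f(1), of "\<epsilon> / 2"] \<open>\<epsilon> > 0\<close> obtain F c where F: "finite F"
    and le: "besicovitch_seminorm 2 (\<lambda>t. f t - (\<Sum>\<mu>\<in>F. c \<mu> * cis (\<mu> * t))) < ennreal (\<epsilon> / 2)" by auto
  have "besicovitch_seminorm 2 (\<lambda>t. g t - (\<Sum>\<mu>\<in>F. c \<mu> * cis (\<mu> * t))) \<le> 
      besicovitch_seminorm 2 (\<lambda>t. g t - f t) +
      besicovitch_seminorm 2 (\<lambda>t. f t - (\<Sum>\<mu>\<in>F. c \<mu> * cis (\<mu> * t)))"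
    by (intro besicovitch_seminorm_diff_triangle assms(1) besicovitch_L2loc[OF f(1)] L2loc_trig_sum)
  also have "\<dots> < ennreal (\<epsilon> / 2) + ennreal (\<epsilon> / 2)" by (rule add_strict_mono[OF f(2) le])
  also have "\<dots> = ennreal \<epsilon>" using \<open>\<epsilon> > 0\<close> by (simp add: ennreal_plus[symmetric] del: ennreal_plus)
  finally show "\<exists>F c. finite F \<and>
      besicovitch_seminorm 2 (\<lambda>t. g t - (\<Sum>\<mu>\<in>F. c \<mu> * cis (\<mu> * t))) < ennreal \<epsilon>"
    using F by blast
qed

text \<open>
  The index of the shell \<open>r k < \<bar>t\<bar> \<le> r (k + 1)\<close> that contains \<open>t\<close>; the points with
  \<open>\<bar>t\<bar> \<le> r 1\<close> get index 0. The glued function is \<open>t \<mapsto> f (shell_index r t) t\<close>.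
\<close>

definition shell_index :: "(nat \<Rightarrow> real) \<Rightarrow> real \<Rightarrow> nat" where
  "shell_index r t = (LEAST k. \<bar>t\<bar> \<le> r (Suc k))"

text \<open>
  The radii at least double, so that a sum of radii up to \<open>r k\<close> is at most \<open>2 * r k\<close>: the errors made
  on the earlier shells add up to a multiple of the length of the current interval.
\<close>

locale shells =
  fixes r :: "nat \<Rightarrow> real"
  assumes r_ge: "2 ^ k \<le> r k" and r_double: "2 * r k \<le> r (Suc k)"
begin

lemma r_pos: "r k > 0"
  by (rule less_le_trans[OF _ r_ge]) simp

lemma r_mono: "i \<le> j \<Longrightarrow> r i \<le> r j"
proof (rule lift_Suc_mono_le[of r])
  show "r n \<le> r (Suc n)" for n using r_double[of n] r_pos[of n] by simp
qed

lemma r_unbounded: "\<exists>k. x \<le> r (Suc k)"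
proof -
  obtain k where "x < 2 ^ k" using real_arch_pow[of 2 x] by auto
  also have "\<dots> \<le> r k" by (rule r_ge)
  also have "\<dots> \<le> r (Suc k)" by (rule r_mono) simp
  finally show ?thesis by (auto intro: less_imp_le)
qed

lemma shell_index_eq: "r k < \<bar>t\<bar> \<Longrightarrow> \<bar>t\<bar> \<le> r (Suc k) \<Longrightarrow> shell_index r t = k"
  unfolding shell_index_def
proof (rule Least_equality)
  fix j assume "r k < \<bar>t\<bar>" "\<bar>t\<bar> \<le> r (Suc j)"
  then show "k \<le> j" using r_mono[of "Suc j" k] by (meson less_le_trans not_le not_less_eq_eq order_less_irrefl)
qed

lemma shell_index_le: "\<bar>t\<bar> \<le> r (Suc k) \<Longrightarrow> shell_index r t \<le> k"
  unfolding shell_index_def by (rule Least_le)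

lemma shell_exists:
  assumes "r m \<le> x"
  obtains k where "m \<le> k" "r k \<le> x" "x \<le> r (Suc k)"
proof -
  define k where "k = (LEAST k. x \<le> r (Suc k))"
  have k: "x \<le> r (Suc k)" unfolding k_def using LeastI_ex[OF r_unbounded] .
  have least: "k \<le> j" if "x \<le> r (Suc j)" for j unfolding k_def by (rule Least_le) (rule that)
  show thesis
  proof (cases "k \<le> m")
    case True
    then have "x \<le> r (Suc m)" using k r_mono[of "Suc k" "Suc m"] by simp
    with assms show ?thesis by (intro that[of m]) auto
  next
    case False
    then obtain j where j: "k = Suc j" "m \<le> j" by (cases k) auto
    with least[of j] have "r k \<le> x" by (metis Suc_n_not_le_n linear)
    with k j show ?thesis by (intro that[of k]) auto
  qed
qed

lemma measurable_shell_index: "shell_index r \<in> lebesgue \<rightarrow>\<^sub>M count_space UNIV"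
proof -
  have [measurable]: "(\<lambda>x::real. x) \<in> borel_measurable lebesgue"
    by (rule measurable_completion) simp
  show ?thesis unfolding shell_index_def[abs_def] by measurable
qed

lemma L2loc_glue:
  assumes "\<And>k. locally_p_integrable 2 (f k)"
  shows "locally_p_integrable 2 (\<lambda>t. f (shell_index r t) t)"
proof (rule L2loc_bound)
  define n where "n a b = (SOME k. max \<bar>a\<bar> \<bar>b\<bar> \<le> r (Suc k))" for a b
  have n: "max \<bar>a\<bar> \<bar>b\<bar> \<le> r (Suc (n a b))" for a b
    unfolding n_def by (rule someI_ex[OF r_unbounded])
  show "(\<lambda>t. f (shell_index r t) t) \<in> borel_measurable lebesgue"
    by (rule measurable_compose_countable[OF L2loc_measurable[OF assms] measurable_shell_index])
  show "set_integrable lebesgue {a..b} (\<lambda>t. \<Sum>i\<le>n a b. (cmod (f i t))\<^sup>2)" for a b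
    using L2loc_square_integrable[OF assms, of a b]
    unfolding set_integrable_def scaleR_sum_right by (intro Bochner_Integration.integrable_sum)
  show "(cmod (f (shell_index r t) t))\<^sup>2 \<le> (\<Sum>i\<le>n a b. (cmod (f i t))\<^sup>2)" if "t \<in> {a..b}" for a b t
  proof -
    have "\<bar>t\<bar> \<le> r (Suc (n a b))" using n[of a b] that by auto
    from shell_index_le[OF this] show ?thesis
      by (intro member_le_sum[where f = "\<lambda>i. (cmod (f i t))\<^sup>2"]) auto
  qed
qed

text \<open>
  On the shell with index \<open>k \<ge> m\<close> the integrand is that of \<open>f k - f m\<close>, whose integral over
  \<open>{-x..x}\<close> is at most \<open>2 x D\<^sup>2\<close>. The bounds for the complete shells form a geometric series
  dominated by the last radius, which gives \<open>4 x D\<^sup>2\<close>; the incomplete shell adds \<open>2 x D\<^sup>2\<close>.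
\<close>

lemma glue_integral_bound:
  fixes f :: "nat \<Rightarrow> real \<Rightarrow> complex"
  assumes f: "\<And>k. locally_p_integrable 2 (f k)"
    and near: "\<And>k x. m \<le> k \<Longrightarrow> r k \<le> x \<Longrightarrow> rms (\<lambda>t. f k t - f m t) x \<le> D"
  defines "J \<equiv> \<lambda>x. LINT t:{-x..x}|lebesgue. (cmod (f (shell_index r t) t - f m t))\<^sup>2"
  assumes "r m \<le> x"
  shows "J x \<le> J (r m) + 6 * x * D\<^sup>2"
proof -
  have glue: "locally_p_integrable 2 (\<lambda>t. f (shell_index r t) t - f m t)"
    by (rule L2loc_diff[OF L2loc_glue[of f, OF f] f])
  have shell: "J x \<le> J (r k) + 2 * x * D\<^sup>2" if k: "m \<le> k" "r k \<le> x" "x \<le> r (Suc k)" for k x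
  proof -
    have "x > 0" using r_pos[of k] k(2) by linarith
    let ?u = "\<lambda>t. (cmod (f (shell_index r t) t - f m t))\<^sup>2" and ?v = "\<lambda>t. (cmod (f k t - f m t))\<^sup>2"
    have v: "set_integrable lebesgue {-x..x} ?v"
      by (intro L2loc_square_integrable L2loc_diff f)
    have u: "set_integrable lebesgue {-y..y} ?u" for y
      by (intro L2loc_square_integrable glue)
    have "J x \<le> (LINT t|lebesgue. indicator {-r k..r k} t *\<^sub>R ?u t + indicator {-x..x} t *\<^sub>R ?v t)"
      unfolding J_def set_lebesgue_integral_def
    proof (rule integral_mono)
      show "integrable lebesgue (\<lambda>t. indicator {-x..x} t *\<^sub>R ?u t)"
        "integrable lebesgue (\<lambda>t. indicator {-r k..r k} t *\<^sub>R ?u t + indicator {-x..x} t *\<^sub>R ?v t)"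
        using u v unfolding set_integrable_def by auto
      show "indicator {-x..x} t *\<^sub>R ?u t \<le> indicator {-r k..r k} t *\<^sub>R ?u t + indicator {-x..x} t *\<^sub>R ?v t" for t
        using shell_index_eq[of k t] k by (auto simp: indicator_def)
    qed
    also have "\<dots> = J (r k) + (LINT t:{-x..x}|lebesgue. ?v t)"
      using u v unfolding J_def set_integrable_def set_lebesgue_integral_def by simp
    also have "(LINT t:{-x..x}|lebesgue. ?v t) = 2 * x * mean_square (\<lambda>t. f k t - f m t) x"
      using \<open>x > 0\<close> by (simp add: mean_square_def)
    also have "\<dots> \<le> 2 * x * D\<^sup>2"
      unfolding rms_sq[OF \<open>x > 0\<close>, symmetric] using \<open>x > 0\<close> near[OF k(1,2)] rms_nonneg[OF \<open>x > 0\<close>]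
      by (intro mult_left_mono power_mono) auto
    finally show ?thesis by simp
  qed
  have ends: "J (r k) \<le> J (r m) + 4 * r k * D\<^sup>2" if "m \<le> k" for k
    using that
  proof (induction k rule: dec_induct)
    case base
    then show ?case using r_pos[of m] by simp
  next
    case (step k)
    have "J (r (Suc k)) \<le> J (r k) + 2 * r (Suc k) * D\<^sup>2"
      using step(1) r_mono[of k "Suc k"] by (intro shell) auto
    also have "\<dots> \<le> J (r m) + 4 * r k * D\<^sup>2 + 2 * r (Suc k) * D\<^sup>2" using step by simp
    also have "\<dots> = J (r m) + 2 * (2 * r k) * D\<^sup>2 + 2 * r (Suc k) * D\<^sup>2" by simp
    also have "\<dots> \<le> J (r m) + 2 * r (Suc k) * D\<^sup>2 + 2 * r (Suc k) * D\<^sup>2"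
      using r_double[of k] by (intro add_right_mono add_left_mono mult_right_mono) auto
    finally show ?case by simp
  qed
  from shell_exists[OF assms(4)] obtain k where k: "m \<le> k" "r k \<le> x" "x \<le> r (Suc k)" .
  have "J x \<le> J (r m) + 4 * r k * D\<^sup>2 + 2 * x * D\<^sup>2" using shell[OF k] ends[OF k(1)] by simp
  also have "\<dots> \<le> J (r m) + 4 * x * D\<^sup>2 + 2 * x * D\<^sup>2" using k by (simp add: mult_right_mono)
  finally show ?thesis by simp
qed

text \<open>
  After division by \<open>2 x\<close> the bound of the previous lemma becomes \<open>3 D\<^sup>2\<close> plus a term that vanishes
  in the limit, and \<open>3 D\<^sup>2 + D\<^sup>2 = (2 D)\<^sup>2\<close>.
\<close>

lemma glue_seminorm_bound:
  fixes f :: "nat \<Rightarrow> real \<Rightarrow> complex"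
  assumes f: "\<And>k. locally_p_integrable 2 (f k)" and "D > 0"
    and near: "\<And>k x. m \<le> k \<Longrightarrow> r k \<le> x \<Longrightarrow> rms (\<lambda>t. f k t - f m t) x \<le> D"
  shows "besicovitch_seminorm 2 (\<lambda>t. f (shell_index r t) t - f m t) \<le> ennreal (2 * D)"
proof -
  let ?h = "\<lambda>t. f (shell_index r t) t - f m t"
  define C where "C = (LINT t:{-r m..r m}|lebesgue. (cmod (?h t))\<^sup>2)"
  have "((\<lambda>x. (C / 2) * (1 / x)) \<longlongrightarrow> (C / 2) * 0) at_top"
    by (intro tendsto_intros tendsto_divide_0[OF tendsto_const] filterlim_at_top_imp_at_infinity
        filterlim_ident)
  then have "\<forall>\<^sub>F x in at_top. (C / 2) * (1 / x) < D\<^sup>2"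
    by (rule order_tendstoD) (use \<open>D > 0\<close> in simp)
  then have ev: "\<forall>\<^sub>F x in at_top. rms ?h x \<le> 2 * D"
    using eventually_ge_at_top[of "r m"]
  proof eventually_elim
    case (elim x)
    have "x > 0" using r_pos[of m] elim by simp
    have "mean_square ?h x \<le> 1 / (2 * x) * (C + 6 * x * D\<^sup>2)"
      unfolding mean_square_def C_def using \<open>x > 0\<close>
      by (intro mult_left_mono glue_integral_bound f near elim) auto
    also have "\<dots> = (C / 2) * (1 / x) + 3 * D\<^sup>2" using \<open>x > 0\<close> by (simp add: field_simps)
    also have "\<dots> \<le> (2 * D)\<^sup>2" using elim(1) by simp
    finally show ?case unfolding rms_def using \<open>D > 0\<close> by (intro real_le_lsqrt) auto
  qed
  have "\<forall>\<^sub>F x in at_top. rms ?h x \<le> 2 * D + e" if "e > 0" for e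
    using ev by (rule eventually_mono) (use that in simp)
  then show ?thesis
    using besicovitch_seminorm_le_iff[OF L2loc_diff[OF L2loc_glue[of f, OF f] f[of m]], of "2 * D"] \<open>D > 0\<close> by simp
qed

end

text \<open>
  The seminorm is an upper limit, so for each pair \<open>i, j\<close> the root mean square of \<open>f i - f j\<close> is
  under control only beyond some radius. The radius \<open>r k\<close> is chosen beyond the thresholds of all pairs
  up to \<open>k\<close>, and on the \<open>k\<close>-th shell the limit function is \<open>f k\<close>.
\<close>

theorem besicovitch_complete:
  fixes f :: "nat \<Rightarrow> real \<Rightarrow> complex"
  assumes f: "\<And>k. f k \<in> besicovitch 2"
    and Cauchy: "\<And>\<epsilon>. \<epsilon> > 0 \<Longrightarrow> \<exists>N. \<forall>m\<ge>N. \<forall>n\<ge>N. besicovitch_seminorm 2 (\<lambda>t. f m t - f n t) < ennreal \<epsilon>"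
  obtains g where "g \<in> besicovitch 2"
    "\<And>\<epsilon>. \<epsilon> > 0 \<Longrightarrow> \<exists>N. \<forall>n\<ge>N. besicovitch_seminorm 2 (\<lambda>t. g t - f n t) < ennreal \<epsilon>"
proof -
  note fL = besicovitch_L2loc[OF f]
  define d where "d i j = enn2real (besicovitch_seminorm 2 (\<lambda>t. f i t - f j t))" for i j
  have d: "besicovitch_seminorm 2 (\<lambda>t. f i t - f j t) = ennreal (d i j)" for i j
    using besicovitch_seminorm_diff_finite[OF f f, of i j] unfolding d_def infinity_ennreal_def
    by (rule ennreal_enn2real[symmetric])
  have d_nonneg: "d i j \<ge> 0" for i j by (simp add: d_def)
  have "\<exists>T. \<forall>i\<le>k. \<forall>j\<le>k. \<forall>x\<ge>T. rms (\<lambda>t. f i t - f j t) x \<le> d i j + 1 / real (Suc k)" for k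
  proof -
    have "\<forall>\<^sub>F x in at_top. rms (\<lambda>t. f i t - f j t) x \<le> d i j + 1 / real (Suc k)" for i j
      using besicovitch_seminorm_le_iff[OF L2loc_diff[OF fL fL] d_nonneg, of i j i j] d[of i j] by simp
    then have "\<forall>\<^sub>F x in at_top. \<forall>i\<in>{..k}. \<forall>j\<in>{..k}. rms (\<lambda>t. f i t - f j t) x \<le> d i j + 1 / real (Suc k)"
      by (intro eventually_ball_finite ballI finite_atMost)
    then show ?thesis unfolding eventually_at_top_linorder by blast
  qed
  then obtain T where T: "\<And>k i j x. i \<le> k \<Longrightarrow> j \<le> k \<Longrightarrow> T k \<le> x \<Longrightarrow> 
      rms (\<lambda>t. f i t - f j t) x \<le> d i j + 1 / real (Suc k)"
    by metis
  \<comment> \<open>The power doubles the radii, and the sum pushes them beyond all thresholds so far.\<close>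
  define r :: "nat \<Rightarrow> real" where "r k = 2 ^ k * (1 + (\<Sum>i\<le>k. \<bar>T i\<bar>))" for k
  have T_le: "T k \<le> r k" for k
  proof -
    have "T k \<le> 1 * (\<Sum>i\<le>k. \<bar>T i\<bar>)"
      using member_le_sum[of k "{..k}" "\<lambda>i. \<bar>T i\<bar>"] by simp
    also have "\<dots> \<le> r k"
      unfolding r_def by (intro mult_mono) (auto simp: sum_nonneg)
    finally show ?thesis .
  qed
  interpret shells r
  proof
    show "2 ^ k \<le> r k" for k by (simp add: r_def sum_nonneg)
    show "2 * r k \<le> r (Suc k)" for k by (simp add: r_def)
  qed
  define g where "g = (\<lambda>t. f (shell_index r t) t)"
  have lim: "\<exists>N. \<forall>n\<ge>N. besicovitch_seminorm 2 (\<lambda>t. g t - f n t) < ennreal \<epsilon>" if "\<epsilon> > 0" for \<epsilon>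
  proof -
    from Cauchy[of "\<epsilon> / 6"] that obtain N1 where 
      N1: "\<And>m n. m \<ge> N1 \<Longrightarrow> n \<ge> N1 \<Longrightarrow> ennreal (d m n) < ennreal (\<epsilon> / 6)" 
      unfolding d by auto
    obtain N2 where "inverse (real (Suc N2)) < \<epsilon> / 6"
      using reals_Archimedean[of "\<epsilon> / 6"] \<open>\<epsilon> > 0\<close> by auto
    then have N2: "1 / real (Suc N2) < \<epsilon> / 6" by (simp only: inverse_eq_divide)
    have "besicovitch_seminorm 2 (\<lambda>t. g t - f m t) < ennreal \<epsilon>" if m: "m \<ge> max N1 N2" for m
    proof -
      have "besicovitch_seminorm 2 (\<lambda>t. g t - f m t) \<le> ennreal (2 * (\<epsilon> / 3))"
        unfolding g_def
      proof (rule glue_seminorm_bound[OF fL])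
        fix k x assume k: "m \<le> k" "r k \<le> x"
        have "rms (\<lambda>t. f k t - f m t) x \<le> d k m + 1 / real (Suc k)"
          using k T_le[of k] by (intro T) auto
        also have "d k m \<le> \<epsilon> / 6" using N1[of k m] m k \<open>\<epsilon> > 0\<close> by (simp add: ennreal_less_iff d_nonneg)
        also have "1 / real (Suc k) \<le> 1 / real (Suc N2)" using m k by (intro divide_left_mono) auto
        also have "\<dots> \<le> \<epsilon> / 6" using N2 by simp
        finally show "rms (\<lambda>t. f k t - f m t) x \<le> \<epsilon> / 3" by simp
      qed (use \<open>\<epsilon> > 0\<close> in simp)
      also have "\<dots> < ennreal \<epsilon>" using \<open>\<epsilon> > 0\<close> by (intro ennreal_lessI) auto
      finally show ?thesis .
    qed
    then show ?thesis by blast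
  qed
  moreover have "g \<in> besicovitch 2"
  proof (rule besicovitch_closed)
    show "locally_p_integrable 2 g" unfolding g_def by (rule L2loc_glue[OF fL])
  qed (use lim f in blast)
  ultimately show thesis using that by blast
qed

section \<open>Characters and rational linear maps\<close>

interpretation rat_pair: vector_space_pair
  "\<lambda>(q::rat) (x::real). of_rat q * x" "\<lambda>(q::rat) (x::real). of_rat q * x"
  by (intro vector_space_pair.intro rat_real.vector_space_axioms)

text \<open>
  The maps \<open>\<psi>\<close> are constructed on the whole real line, as a vector space over the rationals, by
  extension from a linearly independent set.
\<close>

lemma rat_linear_on_linear:
  assumes "Vector_Spaces.linear (\<lambda>(q::rat) (x::real). of_rat q * x) (\<lambda>q x. of_rat q * x) \<psi>"
  shows "rat_linear_on V \<psi>"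
proof -
  interpret Vector_Spaces.linear "\<lambda>(q::rat) (x::real). of_rat q * x" "\<lambda>q x. of_rat q * x" \<psi> by fact
  show ?thesis by (simp add: rat_linear_on_def add scale)
qed

lemma rat_linear_on_sum:
  assumes "rat_linear_on (rat_real.span S) \<psi>" "finite B" "B \<subseteq> rat_real.span S"
  shows "\<psi> (\<Sum>b\<in>B. of_rat (q b) * b) = (\<Sum>b\<in>B. of_rat (q b) * \<psi> b)"
  using assms(2,3)
proof (induction B)
  case empty
  have "\<psi> (of_rat 0 * 0) = of_rat 0 * \<psi> 0"
    using assms(1) rat_real.span_zero unfolding rat_linear_on_def by blast
  then show ?case by simp
next
  case (insert b B)
  then have "of_rat (q b) * b \<in> rat_real.span S" "(\<Sum>b\<in>B. of_rat (q b) * b) \<in> rat_real.span S"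
    by (auto intro!: rat_real.span_scale rat_real.span_sum)
  with insert assms(1) show ?case by (simp add: rat_linear_on_def)
qed

lemma common_denominator:
  fixes Q :: "rat set"
  assumes "finite Q"
  shows "\<exists>N::nat. N > 0 \<and> (\<forall>q\<in>Q. of_nat N * q \<in> \<int>)"
  using assms
proof (induction Q)
  case empty
  show ?case by (intro exI[of _ 1]) simp
next
  case (insert q Q)
  then obtain N where N: "N > 0" "\<forall>q\<in>Q. of_nat N * q \<in> \<int>" by blast
  obtain a b where ab: "quotient_of q = (a, b)" by fastforce
  then have b: "b > 0" and q: "q = of_int a / of_int b"
    using quotient_of_denom_pos quotient_of_div by blast+
  have bq: "of_nat (nat b) * q = of_int a" using b by (simp add: q)
  show ?case
  proof (intro exI[of _ "nat b * N"] conjI ballI)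
    show "nat b * N > 0" using b N by simp
    fix p assume "p \<in> insert q Q"
    then show "of_nat (nat b * N) * p \<in> \<int>"
    proof
      assume "p = q"
      have "of_nat (nat b * N) * q = of_nat N * (of_nat (nat b) * q)" by (simp only: of_nat_mult mult_ac)
      then show ?thesis unfolding \<open>p = q\<close> bq by (simp only: Ints_mult Ints_of_nat Ints_of_int)
    next
      assume "p \<in> Q"
      have "of_nat (nat b * N) * p = of_nat (nat b) * (of_nat N * p)" by (simp only: of_nat_mult mult_ac)
      then show ?thesis using N(2) \<open>p \<in> Q\<close> by (simp only: Ints_mult Ints_of_nat)
    qed
  qed
qed

text \<open>
  Coordinates with respect to a basis over the rationals become integers after the basis is divided
  by a common denominator \<open>N\<close>. Integrality matters because the character at \<open>\<mu>\<close> is then a product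
  of integral powers of its values at the \<open>b / N\<close>, without a choice of roots.
\<close>

lemma integral_coordinates:
  assumes "finite S"
  obtains B :: "real set" and N :: nat and m :: "real \<Rightarrow> real \<Rightarrow> int"
  where "finite B" "B \<subseteq> rat_real.span S" "\<not> rat_real.dependent B" "N > 0"
    "\<And>\<mu>. \<mu> \<in> S \<Longrightarrow> \<mu> = (\<Sum>b\<in>B. of_int (m \<mu> b) * (b / of_nat N))"
proof -
  obtain B where B: "B \<subseteq> S" "\<not> rat_real.dependent B" "S \<subseteq> rat_real.span B"
    using rat_real.maximal_independent_subset[of S] by blast
  have fin: "finite B" using B(1) assms by (rule finite_subset)
  have "\<forall>\<mu>\<in>S. \<exists>u. \<mu> = (\<Sum>b\<in>B. of_rat (u b) * b)"
    using B(3) rat_real.span_finite[OF fin] by blast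
  then obtain u where u: "\<And>\<mu>. \<mu> \<in> S \<Longrightarrow> \<mu> = (\<Sum>b\<in>B. of_rat (u \<mu> b) * b)" by metis
  obtain N :: nat where N: "N > 0" "\<forall>q\<in>(\<lambda>(\<mu>, b). u \<mu> b) ` (S \<times> B). of_nat N * q \<in> \<int>"
    using common_denominator[of "(\<lambda>(\<mu>, b). u \<mu> b) ` (S \<times> B)"] assms fin by auto
  define m where "m \<mu> b = \<lfloor>of_nat N * u \<mu> b\<rfloor>" for \<mu> b
  have m: "of_rat (u \<mu> b) * b = of_int (m \<mu> b) * (b / of_nat N)" if "\<mu> \<in> S" "b \<in> B" for \<mu> b
  proof -
    have "of_int (m \<mu> b) = of_nat N * u \<mu> b"
      unfolding m_def using N(2) that by (auto simp: of_int_floor_cancel)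
    then have "u \<mu> b = of_int (m \<mu> b) / of_nat N" using N(1) by (simp add: field_simps)
    then show ?thesis by (simp add: of_rat_divide)
  qed
  show thesis
  proof (rule that[OF fin _ B(2) N(1)])
    show "B \<subseteq> rat_real.span S" using B(1) rat_real.span_superset by blast
    show "\<mu> = (\<Sum>b\<in>B. of_int (m \<mu> b) * (b / of_nat N))" if "\<mu> \<in> S" for \<mu>
      using u[OF that] m[OF that] by (metis (no_types, lifting) sum.cong)
  qed
qed

lemma cis_sum_of_int:
  "cis (\<Sum>b\<in>B. of_int (m b) * x b) = (\<Prod>b\<in>B. cis (x b) powi m b)"
proof (induction B rule: infinite_finite_induct)
  case (insert b B)
  then show ?case by (simp add: cis_mult[symmetric] cis_power_int)
qed auto

text \<open>
  Integral powers and finite products are continuous, so convergence of characters passes from the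
  divided basis to the exponents.
\<close>

lemma character_limit_on_combinations:
  assumes \<psi>: "rat_linear_on (rat_real.span S) \<psi>" and B: "finite B" "B \<subseteq> rat_real.span S" and "N > 0"
    and \<mu>: "\<mu> = (\<Sum>b\<in>B. of_int (m b) * (b / of_nat N))"
    and lim: "\<And>b. b \<in> B \<Longrightarrow> (\<lambda>k. cis (b / of_nat N * \<tau> k)) \<longlonglongrightarrow> cis (\<psi> b / of_nat N)"
  shows "(\<lambda>k. cis (\<mu> * \<tau> k)) \<longlonglongrightarrow> cis (\<psi> \<mu>)"
proof -
  have "\<psi> \<mu> = \<psi> (\<Sum>b\<in>B. of_rat (of_int (m b) / of_nat N) * b)"
    unfolding \<mu> by (simp add: of_rat_divide)
  also have "\<dots> = (\<Sum>b\<in>B. of_int (m b) * (\<psi> b / of_nat N))"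
    by (subst rat_linear_on_sum[OF \<psi> B]) (simp add: of_rat_divide)
  finally have "cis (\<psi> \<mu>) = (\<Prod>b\<in>B. cis (\<psi> b / of_nat N) powi m b)"
    by (simp only: cis_sum_of_int)
  moreover have "cis (\<mu> * \<tau> k) = (\<Prod>b\<in>B. cis (b / of_nat N * \<tau> k) powi m b)" for k
  proof -
    have "\<mu> * \<tau> k = (\<Sum>b\<in>B. of_int (m b) * (b / of_nat N * \<tau> k))"
      unfolding \<mu> sum_distrib_right by (simp only: mult.assoc)
    then show ?thesis by (simp only: cis_sum_of_int)
  qed
  ultimately show ?thesis
    by (simp only:) (intro tendsto_prod tendsto_power_int lim cis_neq_zero)
qed

text \<open>
  A diagonal argument, in the form of the sequential compactness of a countable product of unit
  circles.
\<close>

lemma convergent_characters_subsequence: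
  fixes \<tau> :: "nat \<Rightarrow> real"
  assumes "countable A"
  obtains s :: "nat \<Rightarrow> nat" and \<zeta> where "strict_mono s"
    "\<And>\<mu>. \<mu> \<in> A \<Longrightarrow> (\<lambda>k. cis (\<mu> * \<tau> (s k))) \<longlonglongrightarrow> \<zeta> \<mu>"
proof -
  obtain e :: "nat \<Rightarrow> real" where e: "A \<subseteq> range e"
    using assms uncountable_def by (metis empty_subsetI order_refl)
  define K where "K = (PiE UNIV (\<lambda>_. sphere 0 1) :: (nat \<Rightarrow> complex) set)"
  have "compactin (product_topology (\<lambda>_. euclidean) UNIV) K"
    unfolding K_def by (subst compactin_PiE) simp
  then have "seq_compact K"
    by (simp add: euclidean_product_topology compact_imp_seq_compact)
  moreover have "\<forall>k. (\<lambda>n. cis (e n * \<tau> k)) \<in> K" by (simp add: K_def PiE_iff)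
  ultimately obtain l s where s: "strict_mono s" and l: "((\<lambda>k n. cis (e n * \<tau> k)) \<circ> s) \<longlonglongrightarrow> l"
    by (rule seq_compactE)
  have lim: "(\<lambda>k. cis (e n * \<tau> (s k))) \<longlonglongrightarrow> l n" for n
  proof -
    have "\<forall>x\<in>UNIV. isCont (\<lambda>x::nat \<Rightarrow> complex. x n) x"
      by (rule continuous_on_eq_continuous_at[OF open_UNIV, THEN iffD1, OF continuous_on_product_coordinates])
    then have "isCont (\<lambda>x::nat \<Rightarrow> complex. x n) l" by blast
    from isCont_tendsto_compose[OF this l] show ?thesis by (simp add: o_def)
  qed
  show thesis
  \<comment> \<open>The enumeration \<open>e\<close> may repeat values; any index of \<open>\<mu>\<close> serves.\<close>
  proof (rule that[OF s, of "\<lambda>\<mu>. l (SOME n. e n = \<mu>)"])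
    fix \<mu> assume "\<mu> \<in> A"
    then have "e (SOME n. e n = \<mu>) = \<mu>" using e by (metis (mono_tags) imageE subsetD someI)
    then show "(\<lambda>k. cis (\<mu> * \<tau> (s k))) \<longlonglongrightarrow> l (SOME n. e n = \<mu>)"
      using lim[of "SOME n. e n = \<mu>"] by simp
  qed
qed

text \<open>
  A limit of characters has modulus 1 at each \<open>b / N\<close>, hence an argument \<open>\<theta>\<close> there. As the basis is
  independent, \<open>\<psi> b = N \<theta>\<close> may be prescribed freely, whatever arguments are chosen.
\<close>

lemma character_limit_is_rat_linear:
  fixes \<tau> :: "nat \<Rightarrow> real"
  assumes "finite S"
  obtains s \<psi> where "strict_mono s" "rat_linear_on (rat_real.span S) \<psi>"
    "\<And>\<mu>. \<mu> \<in> S \<Longrightarrow> (\<lambda>k. cis (\<mu> * \<tau> (s k))) \<longlonglongrightarrow> cis (\<psi> \<mu>)"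
proof -
  obtain B N m where B: "finite B" "B \<subseteq> rat_real.span S" "\<not> rat_real.dependent B" "N > 0"
    and m: "\<And>\<mu>. \<mu> \<in> S \<Longrightarrow> \<mu> = (\<Sum>b\<in>B. of_int (m \<mu> b) * (b / of_nat N))"
    by (rule integral_coordinates[OF assms]) blast
  have "countable ((\<lambda>b. b / of_nat N) ` B)" using B(1) by (simp add: countable_finite)
  then obtain s \<zeta> where s: "strict_mono s"
    and \<zeta>: "\<And>b. b \<in> B \<Longrightarrow> (\<lambda>k. cis (b / of_nat N * \<tau> (s k))) \<longlonglongrightarrow> \<zeta> (b / of_nat N)"
    by (rule convergent_characters_subsequence[of _ \<tau>]) blast
  have "\<exists>\<theta>. \<zeta> (b / of_nat N) = cis \<theta>" if "b \<in> B" for b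
  proof -
    have "cmod (\<zeta> (b / of_nat N)) = 1"
      using tendsto_norm[OF \<zeta>[OF that]] by (simp add: LIMSEQ_const_iff)
    then show ?thesis by (metis cis_Arg norm_eq_zero sgn_div_norm inverse_1 scaleR_one zero_neq_one)
  qed
  then obtain \<theta> where \<theta>: "\<And>b. b \<in> B \<Longrightarrow> \<zeta> (b / of_nat N) = cis (\<theta> b)" by metis
  obtain \<psi> where lin: "Vector_Spaces.linear (\<lambda>(q::rat) (x::real). of_rat q * x) (\<lambda>q x. of_rat q * x) \<psi>" and \<psi>: "\<And>b. b \<in> B \<Longrightarrow> \<psi> b = of_nat N * \<theta> b"
    using rat_pair.linear_independent_extend[OF B(3), of "\<lambda>b. of_nat N * \<theta> b"] by blast
  show thesis
  proof (rule that[OF s rat_linear_on_linear[OF lin]])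
    fix \<mu> assume "\<mu> \<in> S"
    show "(\<lambda>k. cis (\<mu> * \<tau> (s k))) \<longlonglongrightarrow> cis (\<psi> \<mu>)"
    proof (rule character_limit_on_combinations[OF rat_linear_on_linear[OF lin] B(1,2,4) m[OF \<open>\<mu> \<in> S\<close>]])
      show "(\<lambda>k. cis (b / of_nat N * \<tau> (s k))) \<longlonglongrightarrow> cis (\<psi> b / of_nat N)" if "b \<in> B" for b
        using \<zeta>[OF that] \<theta>[OF that] \<psi>[OF that] B(4) by simp
    qed
  qed
qed

interpretation int_real: Modules.module "\<lambda>(r::int) (x::real). of_int r * x"
  by (simp add: Modules.module.intro distrib_left distrib_right)

text \<open>
  Kronecker's theorem asks for independence over the integers.
\<close>

lemma int_independent_if_rat_independent:
  assumes "\<not> rat_real.dependent B"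
  shows "\<not> int_real.dependent B"
proof
  assume "int_real.dependent B"
  then obtain T u where T: "finite T" "T \<subseteq> B" "(\<Sum>v\<in>T. of_int (u v) * v) = 0" "\<exists>v\<in>T. u v \<noteq> 0"
    unfolding int_real.dependent_explicit by blast
  then have "rat_real.dependent B"
    unfolding rat_real.dependent_explicit
    by (intro exI[of _ T] exI[of _ "\<lambda>v. of_int (u v)"]) auto
  with assms show False by blast
qed

lemma dist_cis_le: "cmod (cis x - cis y) \<le> \<bar>x - y\<bar>"
proof -
  have "cmod (cis x - cis y) = cmod (cis y * (cis (x - y) - 1))"
    by (simp add: cis_mult right_diff_distrib)
  also have "\<dots> = cmod (cis (x - y) - 1)" by (simp add: norm_mult)
  also have "\<dots> \<le> \<bar>x - y\<bar>"
    using dist_exp_i_1[of "x - y"] abs_sin_x_le_abs_x[of "(x - y) / 2"]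
    by (simp add: cis_conv_exp)
  finally show ?thesis .
qed

text \<open>
  Kronecker's theorem controls \<open>t b\<close> modulo 1. Applied to the phases \<open>\<alpha> b / (2 \<pi>)\<close> and rescaled by
  \<open>2 \<pi>\<close>, it controls the exponentials.
\<close>

lemma kronecker_characters:
  assumes "finite B" "\<not> rat_real.dependent B" "\<epsilon> > 0"
  obtains t where "\<And>b. b \<in> B \<Longrightarrow> cmod (cis (b * t) - cis (\<alpha> b)) < \<epsilon>"
proof -
  obtain \<theta> where \<theta>: "bij_betw \<theta> {..<card B} B"
    using ex_bij_betw_nat_finite[OF assms(1)] by (auto simp: atLeast0LessThan)
  have indep: "\<not> int_real.dependent (\<theta> ` {..<card B})"
    using int_independent_if_rat_independent[OF assms(2)] bij_betw_imp_surj_on[OF \<theta>] by simp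
  obtain t h where th: "\<And>i. i < card B \<Longrightarrow> 
      \<bar>t * \<theta> i - of_int (h i) - \<alpha> (\<theta> i) / (2 * pi)\<bar> < \<epsilon> / (2 * pi)"
    using Kronecker_thm_1[OF indep bij_betw_imp_inj_on[OF \<theta>], of "\<epsilon> / (2 * pi)" 
        "\<lambda>i. \<alpha> (\<theta> i) / (2 * pi)"] assms(3) by auto
  show thesis
  proof (rule that[of "2 * pi * t"])
    fix b assume "b \<in> B"
    then obtain i where i: "i < card B" "b = \<theta> i" using \<theta> by (auto simp: bij_betw_def)
    have "cis (b * (2 * pi * t)) = cis (b * (2 * pi * t) - 2 * pi * of_int (h i))"
      by (simp add: cis_divide[symmetric])
    then have "cmod (cis (b * (2 * pi * t)) - cis (\<alpha> b)) \<le> 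
        \<bar>b * (2 * pi * t) - 2 * pi * of_int (h i) - \<alpha> b\<bar>"
      using dist_cis_le by metis
    also have "b * (2 * pi * t) - 2 * pi * of_int (h i) - \<alpha> b = 
        2 * pi * (t * \<theta> i - of_int (h i) - \<alpha> (\<theta> i) / (2 * pi))"
      by (simp add: i(2) field_simps)
    also have "\<bar>\<dots>\<bar> = 2 * pi * \<bar>t * \<theta> i - of_int (h i) - \<alpha> (\<theta> i) / (2 * pi)\<bar>"
      by (simp only: abs_mult) simp
    also have "\<dots> < 2 * pi * (\<epsilon> / (2 * pi))"
      by (intro mult_strict_left_mono th i(1)) simp
    also have "\<dots> = \<epsilon>" by simp
    finally show "cmod (cis (b * (2 * pi * t)) - cis (\<alpha> b)) < \<epsilon>" .
  qed
qed

lemma rat_linear_approximated_by_characters: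
  assumes "finite S" "rat_linear_on (rat_real.span S) \<psi>"
  obtains \<tau> :: "nat \<Rightarrow> real" where
    "\<And>\<mu>. \<mu> \<in> S \<Longrightarrow> (\<lambda>k. cis (\<mu> * \<tau> k)) \<longlonglongrightarrow> cis (\<psi> \<mu>)"
proof -
  obtain B N m where B: "finite B" "B \<subseteq> rat_real.span S" "\<not> rat_real.dependent B" "N > 0"
    and m: "\<And>\<mu>. \<mu> \<in> S \<Longrightarrow> \<mu> = (\<Sum>b\<in>B. of_int (m \<mu> b) * (b / of_nat N))"
    by (rule integral_coordinates[OF assms(1)]) blast
  have "\<exists>t. \<forall>b\<in>B. cmod (cis (b * t) - cis (\<psi> b / of_nat N)) < 1 / real (Suc k)" for k
    by (rule kronecker_characters[OF B(1,3), of "1 / real (Suc k)" "\<lambda>b. \<psi> b / of_nat N"]) auto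
  then obtain t where t: "\<And>k b. b \<in> B \<Longrightarrow> cmod (cis (b * t k) - cis (\<psi> b / of_nat N)) < 1 / real (Suc k)"
    by metis
  show thesis
  proof (rule that[of "\<lambda>k. of_nat N * t k"])
    fix \<mu> assume "\<mu> \<in> S"
    show "(\<lambda>k. cis (\<mu> * (of_nat N * t k))) \<longlonglongrightarrow> cis (\<psi> \<mu>)"
    proof (rule character_limit_on_combinations[OF assms(2) B(1,2,4) m[OF \<open>\<mu> \<in> S\<close>]])
      fix b assume "b \<in> B"
      have "(\<lambda>k. cis (b * t k)) \<longlonglongrightarrow> cis (\<psi> b / of_nat N)"
      proof (rule Lim_transform[OF tendsto_const])
        show "(\<lambda>k. cis (b * t k) - cis (\<psi> b / of_nat N)) \<longlonglongrightarrow> 0"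
          by (intro LIMSEQ_norm_0 t \<open>b \<in> B\<close>)
      qed
      then show "(\<lambda>k. cis (b / of_nat N * (of_nat N * t k))) \<longlonglongrightarrow> cis (\<psi> b / of_nat N)"
        using B(4) by simp
    qed
  qed
qed

section \<open>The metric space of classes\<close>

text \<open>
  The distance of two classes is that of arbitrary representatives. The choice by \<open>SOME\<close> makes it a
  total function, and \<open>besicovitch_dist_class\<close> shows its independence of the choice.
\<close>

definition besicovitch_rep :: "(real \<Rightarrow> complex) set \<Rightarrow> real \<Rightarrow> complex" where
  "besicovitch_rep X = (SOME f. f \<in> besicovitch 2 \<and> besicovitch_class 2 f = X)"

definition besicovitch_dist :: "(real \<Rightarrow> complex) set \<Rightarrow> (real \<Rightarrow> complex) set \<Rightarrow> real" where
  "besicovitch_dist X Y = 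
     enn2real (besicovitch_seminorm 2 (\<lambda>t. besicovitch_rep X t - besicovitch_rep Y t))"

lemma besicovitch_class_eq_iff:
  assumes "f \<in> besicovitch 2" "g \<in> besicovitch 2"
  shows "besicovitch_class 2 f = besicovitch_class 2 g \<longleftrightarrow> 
    besicovitch_seminorm 2 (\<lambda>t. f t - g t) = 0"
proof
  assume eq: "besicovitch_class 2 f = besicovitch_class 2 g"
  have "g \<in> besicovitch_class 2 f" unfolding eq using assms(2) by (simp add: besicovitch_class_def)
  then show "besicovitch_seminorm 2 (\<lambda>t. f t - g t) = 0" by (simp add: besicovitch_class_def)
next
  assume 0: "besicovitch_seminorm 2 (\<lambda>t. f t - g t) = 0"
  have "besicovitch_seminorm 2 (\<lambda>t. f t - h t) = besicovitch_seminorm 2 (\<lambda>t. g t - h t)"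
    if "h \<in> besicovitch 2" for h
  proof (rule antisym)
    note L = assms[THEN besicovitch_L2loc] besicovitch_L2loc[OF that]
    show "besicovitch_seminorm 2 (\<lambda>t. f t - h t) \<le> besicovitch_seminorm 2 (\<lambda>t. g t - h t)"
      using besicovitch_seminorm_diff_triangle[OF L] unfolding 0 by simp
    show "besicovitch_seminorm 2 (\<lambda>t. g t - h t) \<le> besicovitch_seminorm 2 (\<lambda>t. f t - h t)"
      using besicovitch_seminorm_diff_triangle[OF L(2,1,3)]
      unfolding besicovitch_seminorm_diff_commute[of 2 g f] 0 by simp
  qed
  then show "besicovitch_class 2 f = besicovitch_class 2 g"
    unfolding besicovitch_class_def by (intro Collect_cong conj_cong refl) simp
qed

lemma besicovitch_rep_class:
  assumes "f \<in> besicovitch 2"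
  shows "besicovitch_rep (besicovitch_class 2 f) \<in> besicovitch 2"
    and "besicovitch_class 2 (besicovitch_rep (besicovitch_class 2 f)) = besicovitch_class 2 f"
proof -
  have "\<exists>g. g \<in> besicovitch 2 \<and> besicovitch_class 2 g = besicovitch_class 2 f" using assms by blast
  from someI_ex[OF this]
  show "besicovitch_rep (besicovitch_class 2 f) \<in> besicovitch 2"
    "besicovitch_class 2 (besicovitch_rep (besicovitch_class 2 f)) = besicovitch_class 2 f"
    by (auto simp: besicovitch_rep_def)
qed

lemma besicovitch_dist_class:
  assumes f: "f \<in> besicovitch 2" and g: "g \<in> besicovitch 2"
  shows "ennreal (besicovitch_dist (besicovitch_class 2 f) (besicovitch_class 2 g)) =
    besicovitch_seminorm 2 (\<lambda>t. f t - g t)"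
proof -
  define f' g' where "f' = besicovitch_rep (besicovitch_class 2 f)" 
    and "g' = besicovitch_rep (besicovitch_class 2 g)"
  have B: "f' \<in> besicovitch 2" "g' \<in> besicovitch 2"
    using besicovitch_rep_class(1) f g by (auto simp: f'_def g'_def)
  note L = besicovitch_L2loc[OF f] besicovitch_L2loc[OF g] besicovitch_L2loc[OF B(1)] besicovitch_L2loc[OF B(2)]
  have 0: "besicovitch_seminorm 2 (\<lambda>t. f t - f' t) = 0" "besicovitch_seminorm 2 (\<lambda>t. g t - g' t) = 0"
    using besicovitch_class_eq_iff[OF f B(1)] besicovitch_class_eq_iff[OF g B(2)]
      besicovitch_rep_class(2) f g by (auto simp: f'_def g'_def)
  note zero' = 0[unfolded besicovitch_seminorm_diff_commute[of 2 f f'] besicovitch_seminorm_diff_commute[of 2 g g']]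
  have "besicovitch_seminorm 2 (\<lambda>t. f t - g t) \<le> besicovitch_seminorm 2 (\<lambda>t. f' t - g t)"
    using besicovitch_seminorm_diff_triangle[OF L(1,3,2)] 0 by simp
  also have "\<dots> \<le> besicovitch_seminorm 2 (\<lambda>t. f' t - g' t)"
    using besicovitch_seminorm_diff_triangle[OF L(3,4,2)] zero' by simp
  finally have 1: "besicovitch_seminorm 2 (\<lambda>t. f t - g t) \<le> besicovitch_seminorm 2 (\<lambda>t. f' t - g' t)" .
  have "besicovitch_seminorm 2 (\<lambda>t. f' t - g' t) \<le> besicovitch_seminorm 2 (\<lambda>t. f t - g' t)"
    using besicovitch_seminorm_diff_triangle[OF L(3,1,4)] zero' by simp
  also have "\<dots> \<le> besicovitch_seminorm 2 (\<lambda>t. f t - g t)"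
    using besicovitch_seminorm_diff_triangle[OF L(1,2,4)] 0 by simp
  finally have "besicovitch_seminorm 2 (\<lambda>t. f' t - g' t) = besicovitch_seminorm 2 (\<lambda>t. f t - g t)"
    using 1 by (rule antisym)
  then have "besicovitch_dist (besicovitch_class 2 f) (besicovitch_class 2 g) = 
      enn2real (besicovitch_seminorm 2 (\<lambda>t. f t - g t))"
    by (simp only: besicovitch_dist_def f'_def g'_def)
  then show ?thesis
    using besicovitch_seminorm_diff_finite[OF f g] by (simp only: ennreal_enn2real infinity_ennreal_def)
qed

lemma besicovitch_dist_less_iff:
  assumes "f \<in> besicovitch 2" "g \<in> besicovitch 2"
  shows "besicovitch_dist (besicovitch_class 2 f) (besicovitch_class 2 g) < \<epsilon> \<longleftrightarrow>
    besicovitch_seminorm 2 (\<lambda>t. f t - g t) < ennreal \<epsilon>"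
  unfolding besicovitch_dist_class[OF assms, symmetric]
  by (subst ennreal_less_iff) (auto simp: besicovitch_dist_def)

interpretation B2: Metric_space "besicovitch_class 2 ` besicovitch 2" besicovitch_dist
proof
  show "0 \<le> besicovitch_dist X Y" for X Y by (simp add: besicovitch_dist_def)
  show "besicovitch_dist X Y = besicovitch_dist Y X" for X Y
    unfolding besicovitch_dist_def
    by (simp only: besicovitch_seminorm_diff_commute[of 2 "besicovitch_rep X"])
next
  fix X Y assume "X \<in> besicovitch_class 2 ` besicovitch 2" "Y \<in> besicovitch_class 2 ` besicovitch 2"
  then obtain f g where fg: "f \<in> besicovitch 2" "g \<in> besicovitch 2" 
    "X = besicovitch_class 2 f" "Y = besicovitch_class 2 g" by blast
  have "besicovitch_dist X Y = 0 \<longleftrightarrow> ennreal (besicovitch_dist X Y) = 0"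
    by (simp add: besicovitch_dist_def)
  then show "besicovitch_dist X Y = 0 \<longleftrightarrow> X = Y"
    using fg by (simp add: besicovitch_dist_class besicovitch_class_eq_iff)
next
  fix X Y Z assume "X \<in> besicovitch_class 2 ` besicovitch 2" "Y \<in> besicovitch_class 2 ` besicovitch 2"
    "Z \<in> besicovitch_class 2 ` besicovitch 2"
  then obtain f g h where fgh: "f \<in> besicovitch 2" "g \<in> besicovitch 2" "h \<in> besicovitch 2"
    "X = besicovitch_class 2 f" "Y = besicovitch_class 2 g" "Z = besicovitch_class 2 h" by blast
  have "ennreal (besicovitch_dist X Z) \<le> ennreal (besicovitch_dist X Y) + ennreal (besicovitch_dist Y Z)"
    using fgh by (simp add: besicovitch_dist_class besicovitch_seminorm_diff_triangle besicovitch_L2loc)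
  also have "\<dots> = ennreal (besicovitch_dist X Y + besicovitch_dist Y Z)"
    by (simp add: besicovitch_dist_def)
  finally show "besicovitch_dist X Z \<le> besicovitch_dist X Y + besicovitch_dist Y Z"
    by (subst (asm) ennreal_le_iff) (auto simp: besicovitch_dist_def)
qed

text \<open>
  The seminorm balls are the preimages of the metric balls under the passage to classes. Therefore
  the theory of metric spaces applies to the given topology.
\<close>

lemma besicovitch_topology_eq_mtopology: "besicovitch_topology 2 = B2.mtopology"
  unfolding topology_eq openin_besicovitch_topology B2.openin_mtopology besicovitch_open_def
proof (intro allI conj_cong refl)
  fix U :: "(real \<Rightarrow> complex) set set"
  assume U: "U \<subseteq> besicovitch_class 2 ` besicovitch 2"
  have ball: "(\<forall>g\<in>besicovitch 2. besicovitch_seminorm 2 (\<lambda>t. g t - f t) < ennreal \<epsilon> \<longrightarrow> besicovitch_class 2 g \<in> U)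
     \<longleftrightarrow> B2.mball (besicovitch_class 2 f) \<epsilon> \<subseteq> U" if "f \<in> besicovitch 2" for f \<epsilon>
    using that by (auto simp: B2.mball_def besicovitch_dist_less_iff besicovitch_seminorm_diff_commute[of 2 f])
  show "(\<forall>f\<in>besicovitch 2. besicovitch_class 2 f \<in> U \<longrightarrow> (\<exists>\<epsilon>>0. \<forall>g\<in>besicovitch 2.
      besicovitch_seminorm 2 (\<lambda>t. g t - f t) < ennreal \<epsilon> \<longrightarrow> besicovitch_class 2 g \<in> U)) \<longleftrightarrow>
      (\<forall>X. X \<in> U \<longrightarrow> (\<exists>r>0. B2.mball X r \<subseteq> U))"
    using U by (auto simp: ball)
qed

lemma besicovitch_mcomplete: "B2.mcomplete"
  unfolding B2.mcomplete_def
proof (intro allI impI)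
  fix \<sigma> assume \<sigma>: "B2.MCauchy \<sigma>"
  then have "\<forall>n. \<exists>f\<in>besicovitch 2. \<sigma> n = besicovitch_class 2 f" 
    unfolding B2.MCauchy_def by blast
  then obtain f where f: "\<And>n. f n \<in> besicovitch 2" and \<sigma>f: "\<And>n. \<sigma> n = besicovitch_class 2 (f n)"
    by metis
  have cau: "\<exists>N. \<forall>m\<ge>N. \<forall>n\<ge>N. besicovitch_seminorm 2 (\<lambda>t. f m t - f n t) < ennreal \<epsilon>" if \<epsilon>: "\<epsilon> > 0" for \<epsilon>
  proof -
    obtain N where N: "\<And>m n. N \<le> m \<Longrightarrow> N \<le> n \<Longrightarrow> besicovitch_dist (\<sigma> m) (\<sigma> n) < \<epsilon>"
      using \<sigma> \<epsilon> unfolding B2.MCauchy_def by meson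
    have "besicovitch_seminorm 2 (\<lambda>t. f m t - f n t) < ennreal \<epsilon>" if "N \<le> m" "N \<le> n" for m n
      using N[OF that] unfolding \<sigma>f besicovitch_dist_less_iff[OF f f] .
    then show ?thesis by blast
  qed
  obtain g where g: "g \<in> besicovitch 2"
    and lim: "\<And>\<epsilon>. \<epsilon> > 0 \<Longrightarrow> \<exists>N. \<forall>n\<ge>N. besicovitch_seminorm 2 (\<lambda>t. g t - f n t) < ennreal \<epsilon>"
  proof (rule besicovitch_complete[OF f])
    show "\<exists>N. \<forall>m\<ge>N. \<forall>n\<ge>N. besicovitch_seminorm 2 (\<lambda>t. f m t - f n t) < ennreal \<epsilon>"
      if "\<epsilon> > 0" for \<epsilon> by (rule cau[OF that])
    fix g assume "g \<in> besicovitch 2" "\<And>\<epsilon>. \<epsilon> > 0 \<Longrightarrow>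
      \<exists>N. \<forall>n\<ge>N. besicovitch_seminorm 2 (\<lambda>t. g t - f n t) < ennreal \<epsilon>"
    then show thesis by (rule that)
  qed
  have "limitin B2.mtopology \<sigma> (besicovitch_class 2 g) sequentially"
    unfolding B2.limit_metric_sequentially
    using g f lim by (auto simp: \<sigma>f besicovitch_dist_less_iff besicovitch_seminorm_diff_commute[of 2 _ g])
  then show "\<exists>X. limitin B2.mtopology \<sigma> X sequentially" by blast
qed

section \<open>Compactness of the closure of the translates\<close>

text \<open>
  Approximate \<open>f\<close> by trigonometric polynomials and pass to a subsequence of the translation
  parameters along which the characters converge at all their exponents. Along it the translates of
  each polynomial converge, to a polynomial with coefficients \<open>c \<mu> * \<zeta> \<mu>\<close>, and the translates of
  \<open>f\<close> stay uniformly close to them.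
\<close>

lemma translates_totally_bounded:
  assumes "f \<in> besicovitch 2"
  shows "B2.mtotally_bounded (range (\<lambda>\<tau>. besicovitch_class 2 (\<lambda>t. f (t + \<tau>))))"
  unfolding B2.mtotally_bounded_sequentially
proof (intro conjI allI impI)
  note f = besicovitch_L2loc[OF assms] and tr = besicovitch_translation[OF assms]
  show "range (\<lambda>\<tau>. besicovitch_class 2 (\<lambda>t. f (t + \<tau>))) \<subseteq> besicovitch_class 2 ` besicovitch 2"
    using tr by auto
  fix \<sigma> :: "nat \<Rightarrow> (real \<Rightarrow> complex) set" assume "range \<sigma> \<subseteq> range (\<lambda>\<tau>. besicovitch_class 2 (\<lambda>t. f (t + \<tau>)))"
  then have "\<forall>n. \<exists>\<tau>. \<sigma> n = besicovitch_class 2 (\<lambda>t. f (t + \<tau>))" by blast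
  then obtain \<tau> where \<sigma>: "\<And>n. \<sigma> n = besicovitch_class 2 (\<lambda>t. f (t + \<tau> n))" by metis
  define near where "near m F c \<longleftrightarrow> finite F \<and> 
      besicovitch_seminorm 2 (\<lambda>t. f t - (\<Sum>\<mu>\<in>F. c \<mu> * cis (\<mu> * t))) < ennreal (1 / real (Suc m))" for m F c
  have "\<exists>F c. near m F c" for m
    unfolding near_def
  proof (rule besicovitch_approx[OF assms])
    show "0 < 1 / real (Suc m)" by simp
  qed blast
  then obtain F c where "\<And>m. near m (F m) (c m)" by metis
  then have F: "\<And>m. finite (F m)" and approx: "\<And>m. 
      besicovitch_seminorm 2 (\<lambda>t. f t - (\<Sum>\<mu>\<in>F m. c m \<mu> * cis (\<mu> * t))) < ennreal (1 / real (Suc m))"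
    unfolding near_def by blast+
  have "countable (\<Union>m. F m)" using F by (intro countable_UN) (auto intro: countable_finite)
  then obtain s \<zeta> where s: "strict_mono s"
    and \<zeta>: "\<And>\<mu>. \<mu> \<in> (\<Union>m. F m) \<Longrightarrow> (\<lambda>k. cis (\<mu> * \<tau> (s k))) \<longlonglongrightarrow> \<zeta> \<mu>"
  proof (rule convergent_characters_subsequence[where \<tau> = \<tau>])
    fix s \<zeta> assume "strict_mono s" 
      "\<And>\<mu>. \<mu> \<in> (\<Union>m. F m) \<Longrightarrow> (\<lambda>k. cis (\<mu> * \<tau> (s k))) \<longlonglongrightarrow> \<zeta> \<mu>"
    then show thesis by (rule that)
  qed
  have "B2.MCauchy (\<sigma> \<circ> s)"
    unfolding B2.MCauchy_def
  proof (intro conjI allI impI)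
    show "range (\<sigma> \<circ> s) \<subseteq> besicovitch_class 2 ` besicovitch 2" using tr by (auto simp: \<sigma>)
    fix \<epsilon> :: real assume "\<epsilon> > 0"
    obtain m where "inverse (real (Suc m)) < \<epsilon> / 4"
      using reals_Archimedean[of "\<epsilon> / 4"] \<open>\<epsilon> > 0\<close> by auto
    then have m: "1 / real (Suc m) < \<epsilon> / 4" by (simp only: inverse_eq_divide)
    \<comment> \<open>The limit of the translates of the \<open>m\<close>-th approximating polynomial.\<close>
    define Q where "Q = (\<lambda>t. \<Sum>\<mu>\<in>F m. (c m \<mu> * \<zeta> \<mu>) * cis (\<mu> * t))"
    have Q: "locally_p_integrable 2 Q" unfolding Q_def by (rule L2loc_trig_sum)
    have "(\<lambda>k. \<Sum>\<mu>\<in>F m. cmod (c m \<mu> * cis (\<mu> * \<tau> (s k)) - c m \<mu> * \<zeta> \<mu>)) \<longlonglongrightarrow> 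
        (\<Sum>\<mu>\<in>F m. cmod (c m \<mu> * \<zeta> \<mu> - c m \<mu> * \<zeta> \<mu>))"
      by (intro tendsto_intros \<zeta>) auto
    then have "\<forall>\<^sub>F k in sequentially. (\<Sum>\<mu>\<in>F m. cmod (c m \<mu> * cis (\<mu> * \<tau> (s k)) - c m \<mu> * \<zeta> \<mu>)) < \<epsilon> / 4"
      by (rule order_tendstoD) (use \<open>\<epsilon> > 0\<close> in simp)
    then obtain N where N: "\<And>k. k \<ge> N \<Longrightarrow> 
        (\<Sum>\<mu>\<in>F m. cmod (c m \<mu> * cis (\<mu> * \<tau> (s k)) - c m \<mu> * \<zeta> \<mu>)) < \<epsilon> / 4"
      unfolding eventually_sequentially by blast
    have near: "besicovitch_seminorm 2 (\<lambda>t. f (t + \<tau> (s k)) - Q t) < ennreal (\<epsilon> / 4 + \<epsilon> / 4)" if "k \<ge> N" for k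
    proof (rule besicovitch_seminorm_diff_less_add[OF besicovitch_L2loc[OF tr] L2loc_trig_sum Q])
      let ?P = "\<lambda>t. \<Sum>\<mu>\<in>F m. c m \<mu> * cis (\<mu> * t)"
      have "besicovitch_seminorm 2 (\<lambda>t. f (t + \<tau> (s k)) - ?P (t + \<tau> (s k))) = 
          besicovitch_seminorm 2 (\<lambda>t. f t - ?P t)"
        by (rule besicovitch_seminorm_translation[OF L2loc_diff[OF f L2loc_trig_sum]])
      also have "\<dots> < ennreal (\<epsilon> / 4)"
        using approx[of m] m by (meson ennreal_leI less_imp_le less_le_trans)
      finally show "besicovitch_seminorm 2 (\<lambda>t. f (t + \<tau> (s k)) - 
          (\<Sum>\<mu>\<in>F m. (c m \<mu> * cis (\<mu> * \<tau> (s k))) * cis (\<mu> * t))) < ennreal (\<epsilon> / 4)"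
        by (simp only: trig_sum_translation)
      show "besicovitch_seminorm 2 (\<lambda>t. (\<Sum>\<mu>\<in>F m. (c m \<mu> * cis (\<mu> * \<tau> (s k))) * cis (\<mu> * t)) - Q t) < ennreal (\<epsilon> / 4)"
        unfolding Q_def using N[OF that] \<open>\<epsilon> > 0\<close>
        by (intro le_less_trans[OF trig_sum_seminorm_diff_le] ennreal_lessI) auto
    qed (use \<open>\<epsilon> > 0\<close> in auto)
    have "besicovitch_dist ((\<sigma> \<circ> s) j) ((\<sigma> \<circ> s) k) < \<epsilon>" if "j \<ge> N" "k \<ge> N" for j k
    proof -
      have "besicovitch_seminorm 2 (\<lambda>t. f (t + \<tau> (s j)) - f (t + \<tau> (s k))) < 
          ennreal ((\<epsilon> / 4 + \<epsilon> / 4) + (\<epsilon> / 4 + \<epsilon> / 4))"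
        using near[OF that(1)] near[OF that(2)] \<open>\<epsilon> > 0\<close>
        by (intro besicovitch_seminorm_diff_less_add[OF besicovitch_L2loc[OF tr] Q besicovitch_L2loc[OF tr]])
           (auto simp: besicovitch_seminorm_diff_commute[of 2 Q])
      then show ?thesis by (simp add: \<sigma> besicovitch_dist_less_iff tr)
    qed
    then show "\<exists>N. \<forall>n n'. N \<le> n \<longrightarrow> N \<le> n' \<longrightarrow> besicovitch_dist ((\<sigma> \<circ> s) n) ((\<sigma> \<circ> s) n') < \<epsilon>" by blast
  qed
  with s show "\<exists>r. strict_mono r \<and> B2.MCauchy (\<sigma> \<circ> r)" by blast
qed

lemma compactin_translates_closure:
  assumes "f \<in> besicovitch 2"
  shows "compactin (besicovitch_topology 2) (translates_closure 2 f)"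
  unfolding translates_closure_def besicovitch_topology_eq_mtopology
  using B2.mtotally_bounded_eq_compact_closure_of[OF besicovitch_mcomplete] translates_totally_bounded[OF assms]
  by blast

section \<open>The closure is the equivalence class\<close>

lemma class_in_translates_closure_iff:
  assumes "f \<in> besicovitch 2" "g \<in> besicovitch 2"
  shows "besicovitch_class 2 g \<in> translates_closure 2 f \<longleftrightarrow>
    (\<forall>\<epsilon>>0. \<exists>\<tau>. besicovitch_seminorm 2 (\<lambda>t. f (t + \<tau>) - g t) < ennreal \<epsilon>)"
proof -
  have dist: "besicovitch_dist (besicovitch_class 2 g) (besicovitch_class 2 (\<lambda>t. f (t + \<tau>))) < \<epsilon> \<longleftrightarrow>
      besicovitch_seminorm 2 (\<lambda>t. f (t + \<tau>) - g t) < ennreal \<epsilon>" for \<tau> \<epsilon>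
    unfolding besicovitch_dist_less_iff[OF assms(2) besicovitch_translation[OF assms(1)]]
    by (simp only: besicovitch_seminorm_diff_commute[of 2 g "\<lambda>t. f (t + \<tau>)"])
  have "besicovitch_class 2 g \<in> besicovitch_class 2 ` besicovitch 2"
    "\<And>\<tau>. besicovitch_class 2 (\<lambda>t. f (t + \<tau>)) \<in> besicovitch_class 2 ` besicovitch 2"
    using assms(2) besicovitch_translation[OF assms(1)] by blast+
  then show ?thesis
    unfolding translates_closure_def besicovitch_topology_eq_mtopology B2.metric_closure_of
    by (simp add: B2.in_mball dist)
qed

lemma translates_closure_subset:
  "translates_closure 2 f \<subseteq> besicovitch_class 2 ` besicovitch 2"
  unfolding translates_closure_def besicovitch_topology_eq_mtopology
  by (rule order_trans[OF closure_of_subset_topspace]) simp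

lemma closure_fourier_coeffs:
  assumes f: "f \<in> besicovitch 2" and g: "g \<in> besicovitch 2"
    and cl: "besicovitch_class 2 g \<in> translates_closure 2 f"
  obtains \<tau> :: "nat \<Rightarrow> real" where
    "\<And>\<mu>. (\<lambda>k. fourier_coeff f \<mu> * cis (\<mu> * \<tau> k)) \<longlonglongrightarrow> fourier_coeff g \<mu>"
proof -
  have "\<forall>k. \<exists>\<tau>. besicovitch_seminorm 2 (\<lambda>t. f (t + \<tau>) - g t) < ennreal (1 / real (Suc k))"
    using cl unfolding class_in_translates_closure_iff[OF f g] by simp
  then obtain \<tau> where \<tau>: "\<And>k. besicovitch_seminorm 2 (\<lambda>t. f (t + \<tau> k) - g t) < ennreal (1 / real (Suc k))"
    by metis
  show thesis
  proof (rule that[of \<tau>], rule Lim_transform[OF tendsto_const])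
    fix \<mu>
    have le: "cmod (fourier_coeff f \<mu> * cis (\<mu> * \<tau> k) - fourier_coeff g \<mu>) \<le> 1 / real (Suc k)" for k
      using fourier_coeff_diff_le[OF besicovitch_translation[OF f] g \<tau>]
      by (simp add: fourier_coeff_translation[OF f])
    have lim: "(\<lambda>k. 1 / real (Suc k)) \<longlonglongrightarrow> 0"
      using LIMSEQ_inverse_real_of_nat by (simp add: inverse_eq_divide)
    show "(\<lambda>k. fourier_coeff f \<mu> * cis (\<mu> * \<tau> k) - fourier_coeff g \<mu>) \<longlonglongrightarrow> 0"
      by (rule Lim_null_comparison[OF always_eventually lim]) (use le in blast)
  qed
qed

lemma exponent_indices_Icc: "n \<in> exponent_indices \<Lambda> \<Longrightarrow> {1..n} \<subseteq> exponent_indices \<Lambda>"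
  by (auto simp: exponent_indices_def)

text \<open>
  The coefficients of the translates converge to those of \<open>g\<close>. In particular those outside \<open>\<Lambda>\<close>
  vanish, and on the first \<open>n\<close> exponents the limit of the characters on a subsequence has the form
  \<open>e\<^sup>i\<^sup>\<psi>\<close>.
\<close>

lemma closure_in_equivalence_class:
  assumes \<Lambda>: "exponent_enumeration \<Lambda> \<omega>" and f: "f \<in> fourier_class_B2 \<Lambda> \<omega>" and g: "g \<in> besicovitch 2"
    and cl: "besicovitch_class 2 g \<in> translates_closure 2 f"
  shows "(f, g) \<in> bohr_equiv \<Lambda> \<omega>"
proof -
  from f obtain a where fB: "f \<in> besicovitch 2" and a: "has_fourier_series f \<Lambda> \<omega> a"
    by (auto simp: fourier_class_B2_def)
  obtain \<tau> where lim: "\<And>\<mu>. (\<lambda>k. fourier_coeff f \<mu> * cis (\<mu> * \<tau> k)) \<longlonglongrightarrow> fourier_coeff g \<mu>"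
    by (rule closure_fourier_coeffs[OF fB g cl]) (rule that)
  define b where "b j = fourier_coeff g (\<omega> j)" for j
  have zero: "fourier_coeff g \<mu> = 0" if "\<mu> \<notin> \<Lambda>" for \<mu>
    using lim[of \<mu>] a that by (simp add: has_fourier_series_def LIMSEQ_const_iff)
  have b: "has_fourier_series g \<Lambda> \<omega> b"
    using zero by (simp add: has_fourier_series_def b_def)
  have "\<exists>\<psi>. rat_linear_on (rat_real.span (\<omega> ` {1..n})) \<psi> \<and>
      (\<forall>j\<in>{1..n}. b j = a j * exp (\<i> * of_real (\<psi> (\<omega> j))))" if n: "n \<in> exponent_indices \<Lambda>" for n
  proof -
    obtain s \<psi> where s: "strict_mono s" and \<psi>: "rat_linear_on (rat_real.span (\<omega> ` {1..n})) \<psi>"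
      and lim\<psi>: "\<And>\<mu>. \<mu> \<in> \<omega> ` {1..n} \<Longrightarrow> (\<lambda>k. cis (\<mu> * \<tau> (s k))) \<longlonglongrightarrow> cis (\<psi> \<mu>)"
      using character_limit_is_rat_linear[of "\<omega> ` {1..n}" \<tau>] by auto
    have "b j = a j * exp (\<i> * of_real (\<psi> (\<omega> j)))" if "j \<in> {1..n}" for j
    proof -
      have "a j = fourier_coeff f (\<omega> j)"
        using a exponent_indices_Icc[OF n] that by (auto simp: has_fourier_series_def)
      then have "(\<lambda>k. a j * cis (\<omega> j * \<tau> (s k))) \<longlonglongrightarrow> b j"
        using LIMSEQ_subseq_LIMSEQ[OF lim[of "\<omega> j"] s] by (simp add: b_def o_def)
      moreover have "(\<lambda>k. a j * cis (\<omega> j * \<tau> (s k))) \<longlonglongrightarrow> a j * cis (\<psi> (\<omega> j))"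
        using that by (intro tendsto_intros lim\<psi>) auto
      ultimately show ?thesis unfolding exp_eq_cis by (rule LIMSEQ_unique)
    qed
    with \<psi> show ?thesis by blast
  qed
  then show ?thesis
    using a b fB g unfolding bohr_equiv_def fourier_class_B2_def by blast
qed

text \<open>
  The value \<open>n = 0\<close>, which is not an admissible index, is kept for the empty set: \<open>\<Lambda>\<close> itself may
  be empty.
\<close>

lemma finite_subset_initial_exponents:
  assumes \<Lambda>: "exponent_enumeration \<Lambda> \<omega>" and "finite A" "A \<subseteq> \<Lambda>"
  obtains n where "n \<in> exponent_indices \<Lambda> \<or> n = 0" "A \<subseteq> \<omega> ` {1..n}"
proof -
  have \<omega>: "\<omega> ` exponent_indices \<Lambda> = \<Lambda>" using \<Lambda> by (simp add: exponent_enumeration_def bij_betw_def)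
  from finite_subset_image[OF \<open>finite A\<close>, of \<omega> "exponent_indices \<Lambda>"] assms(3) \<omega>
  obtain J where J: "J \<subseteq> exponent_indices \<Lambda>" "finite J" "A = \<omega> ` J" by auto
  show thesis
  proof (cases "J = {}")
    case True
    with J show thesis by (intro that[of 0]) auto
  next
    case False
    with J have "Max J \<in> exponent_indices \<Lambda>" using Max_in by blast
    moreover have "J \<subseteq> {1..Max J}" using J by (auto simp: exponent_indices_def)
    ultimately show thesis using J(3) by (intro that[of "Max J"]) auto
  qed
qed

lemma fourier_sum_eq_on_support:
  assumes "finite F" "\<And>\<mu>. \<mu> \<notin> \<Lambda> \<Longrightarrow> fourier_coeff f \<mu> = 0" "F \<inter> \<Lambda> \<subseteq> G" "G \<subseteq> F"
  shows "fourier_sum f F = fourier_sum f G"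
  unfolding fourier_sum_def[abs_def] using assms by (intro ext sum.mono_neutral_right) auto

text \<open>
  Choose \<open>n\<close> so that the Fourier sums of \<open>f\<close> and \<open>g\<close> over the first \<open>n\<close> exponents are accurate, and
  then \<open>\<tau>\<close> by Kronecker's theorem so that the translated sum of \<open>f\<close> is close to that of \<open>g\<close>. Each
  of the three errors is less than \<open>\<epsilon>/3\<close>.
\<close>

lemma equivalence_class_in_closure:
  assumes \<Lambda>: "exponent_enumeration \<Lambda> \<omega>" and eq: "(f, g) \<in> bohr_equiv \<Lambda> \<omega>"
  shows "besicovitch_class 2 g \<in> translates_closure 2 f"
proof -
  from eq have f: "f \<in> besicovitch 2" and g: "g \<in> besicovitch 2"
    by (auto simp: bohr_equiv_def fourier_class_B2_def)
  note L = besicovitch_L2loc[OF f] besicovitch_L2loc[OF g]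
  from eq obtain a b where a: "has_fourier_series f \<Lambda> \<omega> a" and b: "has_fourier_series g \<Lambda> \<omega> b"
    and ab: "\<And>n. n \<in> exponent_indices \<Lambda> \<Longrightarrow> \<exists>\<psi>. rat_linear_on (rat_real.span (\<omega> ` {1..n})) \<psi> \<and>
             (\<forall>j\<in>{1..n}. b j = a j * cis (\<psi> (\<omega> j)))"
    unfolding bohr_equiv_def exp_eq_cis by blast
  have supp: "\<mu> \<notin> \<Lambda> \<Longrightarrow> fourier_coeff f \<mu> = 0" "\<mu> \<notin> \<Lambda> \<Longrightarrow> fourier_coeff g \<mu> = 0" for \<mu>
    using a b by (auto simp: has_fourier_series_def)
  show ?thesis
    unfolding class_in_translates_closure_iff[OF f g]
  proof (intro allI impI)
    fix \<epsilon> :: real assume "\<epsilon> > 0"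
    then have "\<epsilon> / 3 > 0" by simp
    obtain A1 where A1: "finite A1" "\<And>F. finite F \<Longrightarrow> A1 \<subseteq> F \<Longrightarrow> 
        besicovitch_seminorm 2 (\<lambda>t. f t - fourier_sum f F t) < ennreal (\<epsilon> / 3)"
      by (rule fourier_sums_converge[OF f \<open>\<epsilon> / 3 > 0\<close>]) blast
    obtain A2 where A2: "finite A2" "\<And>F. finite F \<Longrightarrow> A2 \<subseteq> F \<Longrightarrow> 
        besicovitch_seminorm 2 (\<lambda>t. g t - fourier_sum g F t) < ennreal (\<epsilon> / 3)"
      by (rule fourier_sums_converge[OF g \<open>\<epsilon> / 3 > 0\<close>]) blast
    obtain n where n: "n \<in> exponent_indices \<Lambda> \<or> n = 0" and An: "(A1 \<union> A2) \<inter> \<Lambda> \<subseteq> \<omega> ` {1..n}"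
      by (rule finite_subset_initial_exponents[OF \<Lambda>, of "(A1 \<union> A2) \<inter> \<Lambda>"]) (use A1 A2 in auto)
    define F where "F = \<omega> ` {1..n}"
    have F: "finite F" by (simp add: F_def)
    have f_sum: "fourier_sum f (F \<union> A1) = fourier_sum f F"
      using F A1(1) An by (intro fourier_sum_eq_on_support[where \<Lambda> = \<Lambda>] supp) (auto simp: F_def)
    have g_sum: "fourier_sum g (F \<union> A2) = fourier_sum g F"
      using F A2(1) An by (intro fourier_sum_eq_on_support[where \<Lambda> = \<Lambda>] supp) (auto simp: F_def)
    have f_near: "besicovitch_seminorm 2 (\<lambda>t. f t - fourier_sum f F t) < ennreal (\<epsilon> / 3)"
      using A1(2)[of "F \<union> A1"] F A1(1) unfolding f_sum by blast
    have g_near: "besicovitch_seminorm 2 (\<lambda>t. g t - fourier_sum g F t) < ennreal (\<epsilon> / 3)"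
      using A2(2)[of "F \<union> A2"] F A2(1) unfolding g_sum by blast
    obtain \<psi> where \<psi>: "rat_linear_on (rat_real.span F) \<psi>" 
      and coeff: "\<And>\<mu>. \<mu> \<in> F \<Longrightarrow> fourier_coeff g \<mu> = fourier_coeff f \<mu> * cis (\<psi> \<mu>)"
    proof (cases "n = 0")
      case True
      then show thesis
        by (intro that[of "\<lambda>_. 0"]) (auto simp: F_def rat_linear_on_def)
    next
      case False
      with n have n: "n \<in> exponent_indices \<Lambda>" by simp
      from ab[OF n] obtain \<psi> where \<psi>: "rat_linear_on (rat_real.span F) \<psi>"
        and *: "\<And>j. j \<in> {1..n} \<Longrightarrow> b j = a j * cis (\<psi> (\<omega> j))" unfolding F_def by blast
      show thesis
      proof (rule that[OF \<psi>])
        fix \<mu> assume "\<mu> \<in> F"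
        then obtain j where j: "j \<in> {1..n}" "\<mu> = \<omega> j" by (auto simp: F_def)
        then have "j \<in> exponent_indices \<Lambda>" using exponent_indices_Icc[OF n] by blast
        with a b *[OF j(1)] j(2) show "fourier_coeff g \<mu> = fourier_coeff f \<mu> * cis (\<psi> \<mu>)"
          by (simp add: has_fourier_series_def)
      qed
    qed
    obtain \<tau> where \<tau>: "\<And>\<mu>. \<mu> \<in> F \<Longrightarrow> (\<lambda>k. cis (\<mu> * \<tau> k)) \<longlonglongrightarrow> cis (\<psi> \<mu>)"
      by (rule rat_linear_approximated_by_characters[OF F \<psi>]) blast
    have "(\<lambda>k. \<Sum>\<mu>\<in>F. cmod (fourier_coeff f \<mu> * cis (\<mu> * \<tau> k) - fourier_coeff g \<mu>)) \<longlonglongrightarrow> 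
        (\<Sum>\<mu>\<in>F. cmod (fourier_coeff f \<mu> * cis (\<psi> \<mu>) - fourier_coeff g \<mu>))"
      by (intro tendsto_intros \<tau>)
    also have "(\<Sum>\<mu>\<in>F. cmod (fourier_coeff f \<mu> * cis (\<psi> \<mu>) - fourier_coeff g \<mu>)) = 0"
      by (simp add: coeff)
    finally have "\<forall>\<^sub>F k in sequentially. 
        (\<Sum>\<mu>\<in>F. cmod (fourier_coeff f \<mu> * cis (\<mu> * \<tau> k) - fourier_coeff g \<mu>)) < \<epsilon> / 3"
      by (rule order_tendstoD) (use \<open>\<epsilon> > 0\<close> in simp)
    then obtain k where k: "(\<Sum>\<mu>\<in>F. cmod (fourier_coeff f \<mu> * cis (\<mu> * \<tau> k) - fourier_coeff g \<mu>)) < \<epsilon> / 3"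
      using eventually_happens'[OF sequentially_bot] by blast
    let ?S = "\<lambda>t. fourier_sum f F (t + \<tau> k)"
    have S: "locally_p_integrable 2 ?S" by (rule L2loc_translation[OF L2loc_fourier_sum])
    have "besicovitch_seminorm 2 (\<lambda>t. ?S t - fourier_sum g F t) < ennreal (\<epsilon> / 3)"
      unfolding fourier_sum_def trig_sum_translation using k \<open>\<epsilon> > 0\<close>
      by (intro le_less_trans[OF trig_sum_seminorm_diff_le] ennreal_lessI) auto
    moreover have "besicovitch_seminorm 2 (\<lambda>t. f (t + \<tau> k) - ?S t) < ennreal (\<epsilon> / 3)"
      using f_near besicovitch_seminorm_translation[OF L2loc_diff[OF L(1) L2loc_fourier_sum[of f F]], of "\<tau> k"]
      by simp
    ultimately have "besicovitch_seminorm 2 (\<lambda>t. f (t + \<tau> k) - fourier_sum g F t) < ennreal (\<epsilon> / 3 + \<epsilon> / 3)"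
      using \<open>\<epsilon> > 0\<close>
      by (intro besicovitch_seminorm_diff_less_add[OF L2loc_translation[OF L(1)] S L2loc_fourier_sum]) auto
    moreover have "besicovitch_seminorm 2 (\<lambda>t. fourier_sum g F t - g t) < ennreal (\<epsilon> / 3)"
      using g_near by (subst besicovitch_seminorm_diff_commute)
    ultimately have "besicovitch_seminorm 2 (\<lambda>t. f (t + \<tau> k) - g t) < ennreal ((\<epsilon> / 3 + \<epsilon> / 3) + \<epsilon> / 3)"
      using \<open>\<epsilon> > 0\<close>
      by (intro besicovitch_seminorm_diff_less_add[OF L2loc_translation[OF L(1)] L2loc_fourier_sum L(2)]) auto
    then show "\<exists>\<tau>. besicovitch_seminorm 2 (\<lambda>t. f (t + \<tau>) - g t) < ennreal \<epsilon>" by (intro exI[of _ "\<tau> k"]) simp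
  qed
qed

theorem corollary6:
  fixes f :: "real \<Rightarrow> complex"
  assumes "f \<in> besicovitch 2"
  shows "compactin (besicovitch_topology 2) (translates_closure 2 f) \<and>
         (\<forall>\<Lambda> \<omega>. exponent_enumeration \<Lambda> \<omega> \<longrightarrow> f \<in> fourier_class_B2 \<Lambda> \<omega> \<longrightarrow>
            translates_closure 2 f = besicovitch_class 2 ` (bohr_equiv \<Lambda> \<omega> `` {f}))"
proof (intro conjI allI impI)
  show "compactin (besicovitch_topology 2) (translates_closure 2 f)"
    by (rule compactin_translates_closure[OF assms])
  fix \<Lambda> \<omega> assume \<Lambda>: "exponent_enumeration \<Lambda> \<omega>" and f: "f \<in> fourier_class_B2 \<Lambda> \<omega>"
  show "translates_closure 2 f = besicovitch_class 2 ` (bohr_equiv \<Lambda> \<omega> `` {f})"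
  proof
    show "translates_closure 2 f \<subseteq> besicovitch_class 2 ` (bohr_equiv \<Lambda> \<omega> `` {f})"
      using translates_closure_subset closure_in_equivalence_class[OF \<Lambda> f] by blast
    show "besicovitch_class 2 ` (bohr_equiv \<Lambda> \<omega> `` {f}) \<subseteq> translates_closure 2 f"
      using equivalence_class_in_closure[OF \<Lambda>] by blast
  qed
qed

end
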